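(* Let $n\ge2$, $n'=\frac n{n-1}$, and let $\Omega\subset\mathbb{R}^n$ be a bounded open set with $|\Omega|=1$. For $0<\theta<1$ and $r\in[1,+\infty)$, $$(L^{n'}(\Omega),L^{(n'}(\Omega))_{\theta,r}=G\Gamma(n',r;w_1,1),\qquad w_1(t)=t^{-1}(1-\log t)^{\frac{r\theta}{n}-1},$$ with equivalent (quasi-)norms.
   Context: $\log$ is the natural logarithm. For measurable $f:\Omega\to\mathbb{R}$, $f_*$ is the decreasing rearrangement of $|f|$ on $(0,1)$: $f_*(s)=\inf\{t\ge0:|\{x:|f(x)|>t\}|\le s\}$, and $f_*^p=(f_* )^p$. Small Lebesgue space $L^{(p}$ ($1<p<\infty$): measurable $f$ with $\|f\|_{L^{(p}}=\int_0^1(1-\log t)^{-1/p}\left(\int_0^t f_*^p(\sigma)\,d\sigma\right)^{1/p}\frac{dt}{t}<\infty$. Generalized Gamma space $G\Gamma(p,m;w_1,w_2)$ ($1\le p,m<\infty$): measurable $f$ with $\left[\int_0^1 w_1(t)\left(\int_0^t f_*^p(\sigma)w_2(\sigma)\,d\sigma\right)^{m/p}dt\right]^{1/m}<\infty$, equipped with this quasinorm. For a compatible couple $(X_0,X_1)$, $K(f,t;X_0,X_1)=\inf_{f=f_0+f_1}(\|f_0\|_{X_0}+t\|f_1\|_{X_1})$, and $(X_0,X_1)_{\theta,r}$ is the set of $f\in X_0+X_1$ with $\|f\|_{(X_0,X_1)_{\theta,r}}=\left(\int_0^1[t^{-\theta}K(f,t;X_0,X_1)]^r\frac{dt}{t}\right)^{1/r}<\infty$.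 Equality of spaces means equality as sets with equivalent quasinorms. *)

theory Defs
  imports "HOL-Analysis.Analysis"
begin

text \<open>
  Spaces of measurable functions are sets of representatives: an element of a space over \<open>M\<close> is a
  function measurable with respect to \<open>M\<close>, and its values outside \<open>space M\<close> are irrelevant.
  Quasinorms take values in \<open>[0, \<infinity>]\<close>.
\<close>

text \<open>Power of an extended nonnegative number; used for exponents \<open>a > 0\<close> only, where \<open>0\<^sup>a = 0\<close>.\<close>

definition epowr :: "ennreal \<Rightarrow> real \<Rightarrow> ennreal" where
  "epowr x a = (if x = \<infinity> then \<infinity> else ennreal (enn2real x powr a))"

text \<open>
  The infimum is over a nonempty set when \<open>M\<close> is a finite measure, \<open>f\<close> is measurable and \<open>s > 0\<close>.
\<close>

definition decr_rearr :: "'a measure \<Rightarrow> ('a \<Rightarrow> real) \<Rightarrow> real \<Rightarrow> real" where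
  "decr_rearr M f s = Inf {t. 0 \<le> t \<and> emeasure M {x \<in> space M. \<bar>f x\<bar> > t} \<le> ennreal s}"

definition Lp_norm :: "'a measure \<Rightarrow> real \<Rightarrow> ('a \<Rightarrow> real) \<Rightarrow> ennreal" where
  "Lp_norm M p f = epowr (\<integral>\<^sup>+ x. ennreal (\<bar>f x\<bar> powr p) \<partial>M) (1 / p)"

definition small_Lp_norm :: "'a measure \<Rightarrow> real \<Rightarrow> ('a \<Rightarrow> real) \<Rightarrow> ennreal" where
  "small_Lp_norm M p f =
     (\<integral>\<^sup>+ t\<in>{0<..<1}. ennreal ((1 - ln t) powr (- (1 / p)) / t)
        * epowr (\<integral>\<^sup>+ \<sigma>\<in>{0<..<t}. ennreal (decr_rearr M f \<sigma> powr p) \<partial>lborel) (1 / p) \<partial>lborel)"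

definition GGamma_norm ::
    "'a measure \<Rightarrow> real \<Rightarrow> real \<Rightarrow> (real \<Rightarrow> real) \<Rightarrow> (real \<Rightarrow> real) \<Rightarrow> ('a \<Rightarrow> real) \<Rightarrow> ennreal" where
  "GGamma_norm M p m w1 w2 f =
     epowr (\<integral>\<^sup>+ t\<in>{0<..<1}. ennreal (w1 t)
        * epowr (\<integral>\<^sup>+ \<sigma>\<in>{0<..<t}. ennreal (decr_rearr M f \<sigma> powr p * w2 \<sigma>) \<partial>lborel) (m / p)
        \<partial>lborel) (1 / m)"

text \<open>The space on which a \<open>[0, \<infinity>]\<close>-valued quasinorm is finite.\<close>

definition fun_space :: "'a measure \<Rightarrow> (('a \<Rightarrow> real) \<Rightarrow> ennreal) \<Rightarrow> ('a \<Rightarrow> real) set" where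
  "fun_space M N = {f \<in> borel_measurable M. N f < \<infinity>}"

text \<open>
  Couples of spaces \<open>fun_space M N0\<close>, \<open>fun_space M N1\<close> are compatible as both are contained in the
  space of measurable functions modulo almost everywhere equality; hence decompositions
  \<open>f = f0 + f1\<close> hold almost everywhere.
\<close>

definition decompositions ::
    "'a measure \<Rightarrow> (('a \<Rightarrow> real) \<Rightarrow> ennreal) \<Rightarrow> (('a \<Rightarrow> real) \<Rightarrow> ennreal) \<Rightarrow> ('a \<Rightarrow> real)
      \<Rightarrow> (('a \<Rightarrow> real) \<times> ('a \<Rightarrow> real)) set" where
  "decompositions M N0 N1 f =
     {(f0, f1). f0 \<in> fun_space M N0 \<and> f1 \<in> fun_space M N1 \<and> (AE x in M. f x = f0 x + f1 x)}"

definition K_functional ::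
    "'a measure \<Rightarrow> (('a \<Rightarrow> real) \<Rightarrow> ennreal) \<Rightarrow> (('a \<Rightarrow> real) \<Rightarrow> ennreal) \<Rightarrow> ('a \<Rightarrow> real) \<Rightarrow> real
      \<Rightarrow> ennreal" where
  "K_functional M N0 N1 f t =
     (INF (f0, f1) \<in> decompositions M N0 N1 f. N0 f0 + ennreal t * N1 f1)"

definition interp_norm ::
    "'a measure \<Rightarrow> (('a \<Rightarrow> real) \<Rightarrow> ennreal) \<Rightarrow> (('a \<Rightarrow> real) \<Rightarrow> ennreal) \<Rightarrow> real \<Rightarrow> real
      \<Rightarrow> ('a \<Rightarrow> real) \<Rightarrow> ennreal" where
  "interp_norm M N0 N1 \<theta> r f =
     epowr (\<integral>\<^sup>+ t\<in>{0<..<1}. epowr (ennreal (t powr (- \<theta>)) * K_functional M N0 N1 f t) r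
        * ennreal (1 / t) \<partial>lborel) (1 / r)"

definition interp_space ::
    "'a measure \<Rightarrow> (('a \<Rightarrow> real) \<Rightarrow> ennreal) \<Rightarrow> (('a \<Rightarrow> real) \<Rightarrow> ennreal) \<Rightarrow> real \<Rightarrow> real
      \<Rightarrow> ('a \<Rightarrow> real) set" where
  "interp_space M N0 N1 \<theta> r =
     {f \<in> borel_measurable M. decompositions M N0 N1 f \<noteq> {} \<and> interp_norm M N0 N1 \<theta> r f < \<infinity>}"

definition equivalent_on ::
    "('a \<Rightarrow> real) set \<Rightarrow> (('a \<Rightarrow> real) \<Rightarrow> ennreal) \<Rightarrow> (('a \<Rightarrow> real) \<Rightarrow> ennreal) \<Rightarrow> bool" where
  "equivalent_on X N N' \<longleftrightarrow>
     (\<exists>c C :: real. 0 < c \<and> 0 < C \<and>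
        (\<forall>f\<in>X. ennreal c * N f \<le> N' f \<and> N' f \<le> ennreal C * N f))"

end

theory Submission
  imports Defs
begin

text \<open>
  Let \<open>\<Phi>(t)\<close> be the \<open>L\<^sup>p\<close> norm of the decreasing rearrangement of \<open>f\<close> over \<open>{0<..<t}\<close> (the head norm
  below), let \<open>l(t) = 1 - ln t\<close> and \<open>\<beta> = 1 - 1 / p\<close>, so that \<open>\<beta> = 1 / n\<close> for the exponent of the
  theorem. Then \<open>\<Phi>(1)\<close> is the norm of \<open>L\<^sup>p\<close>, the norm of the small Lebesgue space is the integral of
  \<open>l(t) powr (\<beta> - 1) * \<Phi>(t)\<close> against \<open>dt / t\<close>, and the Gamma norm is a weighted \<open>L\<^sup>r\<close> norm of \<open>\<Phi>\<close>
  against \<open>dt / t\<close>. So everything reduces to one monotone function on \<open>{0<..<1}\<close>.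

  The heart of the matter is a description of the K-functional at \<open>s = l(t) powr (- \<beta>)\<close>. Cutting \<open>f\<close>
  at the height of its rearrangement at \<open>t\<close> gives (\<open>K_functional_le\<close>), up to constants,
  the upper bound \<open>\<Phi>(t) + l(t) powr (- \<beta>) * A(t)\<close>, where \<open>A(t)\<close> is the part over \<open>{t<..<1}\<close> of the integral
  for the small Lebesgue norm. Conversely, \<open>\<Phi>(t)\<close> alone is a lower bound
  (\<open>head_norm_le_K_functional\<close>): the head norm is quasi-subadditive, bounded by the \<open>L\<^sup>p\<close> norm, and
  bounded by \<open>l(t) powr (- \<beta>)\<close> times the small Lebesgue norm. The last fact uses that \<open>\<Phi>(t)\<close> and
  \<open>\<Phi>(t / e)\<close> are comparable, since the rearrangement is decreasing.

  As \<open>s\<close> runs through \<open>{0<..<1}\<close>, so does \<open>t\<close>, and \<open>ds / s\<close> becomes \<open>\<beta> / l(t)\<close> times \<open>dt / t\<close>. Under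
  this substitution the term \<open>\<Phi>(t)\<close> contributes a constant multiple of the Gamma norm to the
  interpolation norm. The contribution of
  \<open>A(t)\<close> is bounded by the same quantity through a Hardy inequality with logarithmic weights
  (\<open>hardy_log_powr\<close>), which holds because \<open>\<theta> < 1\<close>. The two norms are therefore comparable for every
  measurable \<open>f\<close>, including the value \<open>\<infinity>\<close>, which gives the equality of the spaces as well.
\<close>

section \<open>Powers of extended nonnegative numbers\<close>

lemma epowr_ennreal: "0 \<le> x \<Longrightarrow> epowr (ennreal x) a = ennreal (x powr a)"
  by (simp add: epowr_def)

lemma epowr_top [simp]: "epowr top a = top"
  by (simp add: epowr_def)

lemma epowr_zero [simp]: "epowr 0 a = 0"
  by (simp add: epowr_def)

lemma measurable_epowr [measurable]: "(\<lambda>x. epowr x a) \<in> borel_measurable borel"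
  unfolding epowr_def by measurable

lemma epowr_mono:
  assumes "x \<le> y" "0 \<le> a" shows "epowr x a \<le> epowr y a"
proof (cases "y = top")
  case False
  then have "x \<noteq> top" using assms top_unique by auto
  then show ?thesis using assms False
    by (auto simp: epowr_def less_top intro!: ennreal_leI powr_mono2 enn2real_mono)
qed simp

lemma epowr_eq_0_iff: "epowr x a = 0 \<longleftrightarrow> x = 0"
  by (simp add: epowr_def enn2real_eq_0_iff ennreal_eq_0_iff flip: infinity_ennreal_def)

lemma epowr_mult: "epowr (x * y) a = epowr x a * epowr y a"
proof (cases "x = top \<or> y = top")
  case True
  then show ?thesis
    by (auto simp: ennreal_top_mult ennreal_mult_top epowr_eq_0_iff)
next
  case False
  then have "x = ennreal (enn2real x)" "y = ennreal (enn2real y)"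
    by (simp_all add: less_top)
  moreover have "epowr (ennreal u * ennreal v) a = epowr (ennreal u) a * epowr (ennreal v) a"
    if "0 \<le> u" "0 \<le> v" for u v
    using that by (simp add: epowr_ennreal powr_mult flip: ennreal_mult)
  ultimately show ?thesis by (metis enn2real_nonneg)
qed

lemma epowr_epowr: "epowr (epowr x a) b = epowr x (a * b)"
  by (cases x) (simp_all add: epowr_ennreal powr_powr)

text \<open>
  The crude constant from \<open>x + y \<le> 2 * max x y\<close> serves exponents on both sides of \<open>1\<close>.
\<close>

lemma epowr_add_le:
  assumes "0 < a"
  shows "epowr (x + y) a \<le> ennreal (2 powr a) * (epowr x a + epowr y a)"
proof -
  have "x + y \<le> ennreal 2 * max x y"
    using add_mono[OF max.cobounded1[of x y] max.cobounded2[of y x]] by (simp add: mult_2)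
  then have "epowr (x + y) a \<le> epowr (ennreal 2 * max x y) a"
    using assms by (intro epowr_mono) auto
  also have "\<dots> = ennreal (2 powr a) * epowr (max x y) a"
    using assms by (simp add: epowr_mult epowr_ennreal del: ennreal_numeral)
  also have "epowr (max x y) a \<le> epowr x a + epowr y a"
    by (auto simp: max_def)
  finally show ?thesis by (simp add: mult_left_mono)
qed

section \<open>Integrals against powers of 1 - ln t\<close>

text \<open>
  The change of variable \<open>s = (1 - ln t) powr (- \<beta>)\<close> identifies the variable of the K-functional
  with the variable of the rearrangement. Its derivative blows up at \<open>0\<close>, so the substitution is made
  on compact intervals that exhaust \<open>{0<..1}\<close>.
\<close>

lemma nn_integral_subst_log_powr:
  fixes h :: "real \<Rightarrow> ennreal"
  assumes [measurable]: "h \<in> borel_measurable borel" and "0 < \<beta>"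
  shows "(\<integral>\<^sup>+ s\<in>{0<..<1}. h s \<partial>lborel)
       = (\<integral>\<^sup>+ t\<in>{0<..<1}. h ((1 - ln t) powr (- \<beta>))
            * ennreal (\<beta> * (1 - ln t) powr (- \<beta> - 1) / t) \<partial>lborel)"
proof -
  define g g' where "g = (\<lambda>t::real. (1 - ln t) powr (- \<beta>))"
    and "g' = (\<lambda>t::real. \<beta> * (1 - ln t) powr (- \<beta> - 1) / t)"
  define e where "e = (\<lambda>k::nat. 1 / real (k + 2))"
  have e: "0 < e k" "e k < 1" for k by (auto simp: e_def)
  have e_dec: "decseq e" by (auto simp: decseq_def e_def intro!: divide_left_mono)
  have e_lim: "e \<longlonglongrightarrow> 0"
    unfolding e_def using LIMSEQ_ignore_initial_segment[OF lim_1_over_n, of 2] by simp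
  have ln1: "1 - ln t > 0" if "0 < t" "t \<le> 1" for t :: real
    using that by (smt (verit) ln_le_zero_iff)
  have part: "(\<integral>\<^sup>+ s. h s * indicator {g (e k)..1} s \<partial>lborel)
            = (\<integral>\<^sup>+ t. h (g t) * ennreal (g' t) * indicator {e k..1} t \<partial>lborel)" for k
  proof -
    have "(\<integral>\<^sup>+ s. h s * indicator {g (e k)..g 1} s \<partial>lborel)
            = (\<integral>\<^sup>+ t. h (g t) * ennreal (g' t) * indicator {e k..1} t \<partial>lborel)"
    proof (rule nn_integral_substitution_aux)
      fix x assume "x \<in> {e k..1}"
      then have x: "0 < x" "x \<le> 1" using e[of k] by auto
      show "(g has_real_derivative g' x) (at x)"
        unfolding g_def g'_def using x ln1[of x]
        by (auto intro!: derivative_eq_intros simp: field_simps powr_diff)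
      show "0 \<le> g' x" using x \<open>0 < \<beta>\<close> by (simp add: g'_def)
    next
      show "continuous_on {e k..1} g'"
        unfolding g'_def
      proof -
        have "x \<noteq> 0" "1 - ln x \<noteq> 0" if "x \<in> {e k..1}" for x
          using that e(1)[of k] ln1[of x] by auto
        then show "continuous_on {e k..1} (\<lambda>t. \<beta> * (1 - ln t) powr (- \<beta> - 1) / t)"
          by (intro continuous_intros) auto
      qed
    qed (use e in auto)
    then show ?thesis by (simp add: g_def)
  qed
  have g_pos: "0 < g t" if "0 < t" "t \<le> 1" for t
    using that ln1[of t] by (auto simp: g_def)
  have g_le: "g t \<le> g t'" if "0 < t" "t \<le> t'" "t' \<le> 1" for t t'
    using that ln1[of t'] \<open>0 < \<beta>\<close> unfolding g_def by (intro powr_mono2') auto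
  have g_lim: "(\<lambda>k. g (e k)) \<longlonglongrightarrow> 0"
  proof -
    have "filterlim (\<lambda>k. 1 - ln (e k)) at_top sequentially"
    proof -
      have "filterlim e (at_right 0) sequentially"
        using e_lim e by (intro tendsto_imp_filterlim_at_right) auto
      then have "filterlim (\<lambda>k. ln (e k)) at_bot sequentially"
        by (rule filterlim_compose[OF ln_at_0])
      then show ?thesis
        by (intro filterlim_tendsto_add_at_top[where f="\<lambda>_. 1" and g="\<lambda>k. - ln (e k)", simplified])
           (auto simp: filterlim_uminus_at_top)
    qed
    then show ?thesis unfolding g_def
      using \<open>0 < \<beta>\<close> by (intro tendsto_neg_powr) auto
  qed
  have sup_ind: "(SUP k. indicator {a k..1} s) = (indicator {0<..1} s :: ennreal)"
    if "decseq a" "a \<longlonglongrightarrow> 0" "\<And>k. 0 < a k" for a :: "nat \<Rightarrow> real" and s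
  proof (cases "s \<in> {0<..1}")
    case True
    then have "eventually (\<lambda>k. a k < s) sequentially"
      using order_tendstoD(2)[OF that(2)] by auto
    then obtain k where "a k \<le> s" by (meson eventually_sequentially less_imp_le order_refl)
    with True show ?thesis
      by (intro antisym SUP_least SUP_upper2[of k]) (auto simp: indicator_def)
  next
    case False
    then have "\<And>k. s \<notin> {a k..1}" using that(3) by (fastforce dest: less_le_trans)
    with False show ?thesis by simp
  qed
  have conv: "(\<integral>\<^sup>+ s. F s * indicator {0<..1} s \<partial>lborel)
        = (SUP k. \<integral>\<^sup>+ s. F s * indicator {a k..1} s \<partial>lborel)"
    if "decseq a" "a \<longlonglongrightarrow> 0" "\<And>k. 0 < a k" and [measurable]: "F \<in> borel_measurable borel"
    for a :: "nat \<Rightarrow> real" and F :: "real \<Rightarrow> ennreal"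
  proof -
    have "(\<integral>\<^sup>+ s. F s * indicator {0<..1} s \<partial>lborel)
        = (\<integral>\<^sup>+ s. (SUP k. F s * indicator {a k..1} s) \<partial>lborel)"
      by (simp add: sup_ind[OF that(1-3), symmetric] SUP_mult_left_ennreal)
    also have "\<dots> = (SUP k. \<integral>\<^sup>+ s. F s * indicator {a k..1} s \<partial>lborel)"
    proof (rule nn_integral_monotone_convergence_SUP)
      show "incseq (\<lambda>k s. F s * indicator {a k..1} s)"
        using \<open>decseq a\<close>
        by (auto simp: incseq_def le_fun_def decseq_def indicator_def intro!: mult_left_mono)
           (meson order_trans)
    qed measurable
    finally show ?thesis .
  qed
  have closed: "(\<integral>\<^sup>+ s\<in>{0<..<1}. F s \<partial>lborel) = (\<integral>\<^sup>+ s. F s * indicator {0<..1} s \<partial>lborel)"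
    for F :: "real \<Rightarrow> ennreal"
    by (intro nn_integral_cong_AE eventually_mono[OF AE_lborel_singleton[of 1]])
       (auto simp: indicator_def)
  have [measurable]: "g \<in> borel_measurable borel" "g' \<in> borel_measurable borel"
    unfolding g_def g'_def by measurable
  have "(\<integral>\<^sup>+ s\<in>{0<..<1}. h s \<partial>lborel) = (SUP k. \<integral>\<^sup>+ s. h s * indicator {g (e k)..1} s \<partial>lborel)"
    unfolding closed
  proof (rule conv)
    show "decseq (\<lambda>k. g (e k))"
      using e_dec e(1) less_imp_le[OF e(2)] by (auto simp: decseq_def intro!: g_le)
  qed (use g_lim g_pos e in \<open>auto simp: less_imp_le\<close>)
  also have "\<dots> = (SUP k. \<integral>\<^sup>+ t. h (g t) * ennreal (g' t) * indicator {e k..1} t \<partial>lborel)"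
    by (simp add: part)
  also have "\<dots> = (\<integral>\<^sup>+ t\<in>{0<..<1}. h (g t) * ennreal (g' t) \<partial>lborel)"
    unfolding closed by (rule conv[symmetric]) (use e_dec e_lim e in auto)
  finally show ?thesis by (simp add: g_def g'_def)
qed

text \<open>
  The substitution above, applied to an indicator, yields this integral although the antiderivative
  is not defined at the endpoint \<open>0\<close>.
\<close>

lemma nn_integral_log_powr_below:
  assumes "0 < \<delta>" "0 < t" "t < 1"
  shows "(\<integral>\<^sup>+ x\<in>{0<..<t}. ennreal ((1 - ln x) powr (- \<delta> - 1) / x) \<partial>lborel)
       = ennreal ((1 - ln t) powr (- \<delta>) / \<delta>)"
proof -
  define L where "L = 1 - ln t"
  define c where "c = L powr (- \<delta>)"
  have lt: "1 < L" using assms by (simp add: L_def)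
  have c: "0 < c" "c < 1"
    using lt assms by (auto simp: c_def powr_less_one)
  have iff: "(1 - ln x) powr (- \<delta>) < c \<longleftrightarrow> x < t" if "0 < x" "x < 1" for x
  proof -
    have "1 < 1 - ln x" using that by simp
    then have "(1 - ln x) powr (- \<delta>) < c \<longleftrightarrow> L < 1 - ln x"
      unfolding c_def using lt assms(1) powr_less_mono2_neg[of "- \<delta>" L "1 - ln x"]
        powr_mono2'[of "- \<delta>" "1 - ln x" L] by linarith
    then show ?thesis using that assms by (simp add: L_def)
  qed
  have "ennreal c = (\<integral>\<^sup>+ s\<in>{0<..<1}. indicator {..<c} s \<partial>lborel)"
  proof -
    have "(\<integral>\<^sup>+ s\<in>{0<..<1}. indicator {..<c} s \<partial>lborel) = (\<integral>\<^sup>+ s. indicator {0<..<c} s \<partial>lborel)"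
      using c by (intro nn_integral_cong) (auto simp: indicator_def)
    then show ?thesis using c by simp
  qed
  also have "\<dots> = (\<integral>\<^sup>+ x\<in>{0<..<1}. indicator {..<c} ((1 - ln x) powr (- \<delta>))
            * ennreal (\<delta> * (1 - ln x) powr (- \<delta> - 1) / x) \<partial>lborel)"
    using assms by (intro nn_integral_subst_log_powr) auto
  also have "\<dots> = (\<integral>\<^sup>+ x. ennreal \<delta> * (ennreal ((1 - ln x) powr (- \<delta> - 1) / x) * indicator {0<..<t} x) \<partial>lborel)"
    using assms iff
    by (intro nn_integral_cong) (auto simp: indicator_def simp flip: ennreal_mult)
  also have "\<dots> = ennreal \<delta> * (\<integral>\<^sup>+ x\<in>{0<..<t}. ennreal ((1 - ln x) powr (- \<delta> - 1) / x) \<partial>lborel)"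
    by (intro nn_integral_cmult) measurable
  finally have *: "ennreal \<delta> * (\<integral>\<^sup>+ x\<in>{0<..<t}. ennreal ((1 - ln x) powr (- \<delta> - 1) / x) \<partial>lborel) = ennreal c"
    by simp
  show ?thesis
  proof (cases "\<integral>\<^sup>+ x\<in>{0<..<t}. ennreal ((1 - ln x) powr (- \<delta> - 1) / x) \<partial>lborel")
    case (real y)
    then show ?thesis using * assms c unfolding L_def[symmetric] c_def[symmetric]
      by (simp add: ennreal_inj field_simps flip: ennreal_mult)
  next
    case top
    then show ?thesis using * assms by (simp add: ennreal_mult_top)
  qed
qed

lemma nn_integral_log_powr_above:
  assumes "0 < \<delta>" "0 < t" "t < 1"
  shows "(\<integral>\<^sup>+ x\<in>{t<..<1}. ennreal ((1 - ln x) powr (\<delta> - 1) / x) \<partial>lborel)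
       \<le> ennreal ((1 - ln t) powr \<delta> / \<delta>)"
proof -
  let ?F = "\<lambda>x. - ((1 - ln x) powr \<delta> / \<delta>)"
  have "(\<integral>\<^sup>+ x\<in>{t<..<1}. ennreal ((1 - ln x) powr (\<delta> - 1) / x) \<partial>lborel)
     \<le> (\<integral>\<^sup>+ x. ennreal ((1 - ln x) powr (\<delta> - 1) / x) * indicator {t..1} x \<partial>lborel)"
    by (intro nn_integral_mono) (auto simp: indicator_def)
  also have "\<dots> = ennreal (?F 1 - ?F t)"
  proof (rule nn_integral_FTC_Icc[where F="?F"])
    fix x assume "x \<in> {t..1}"
    then have x: "t \<le> x" "x \<le> 1" by auto
    with assms have "0 < x" "0 < 1 - ln x" by (auto simp: ln_le_zero_iff intro: le_less_trans[of _ 0])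
    then show "(?F has_real_derivative ((1 - ln x) powr (\<delta> - 1) / x)) (at x)"
      using assms by (auto intro!: derivative_eq_intros simp: field_simps powr_diff)
    show "0 \<le> (1 - ln x) powr (\<delta> - 1) / x" using \<open>0 < x\<close> by simp
  qed (use assms in auto)
  also have "\<dots> \<le> ennreal ((1 - ln t) powr \<delta> / \<delta>)"
    using assms by (intro ennreal_leI) (auto simp: field_simps)
  finally show ?thesis .
qed

section \<open>A Hardy inequality with logarithmic weights\<close>

text \<open>
  The graph of the convex function \<open>y powr r\<close> lies above its tangent at \<open>c\<close>, written without
  subtraction so that it holds for the value \<open>\<infinity>\<close> as well.
\<close>

lemma epowr_tangent:
  assumes "1 \<le> r" "0 < c"
  shows "ennreal (r * c powr (r - 1)) * y \<le> epowr y r + ennreal ((r - 1) * c powr r)"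
proof (cases y)
  case (real u)
  have "r * c powr (r - 1) * u \<le> u powr r + (r - 1) * c powr r"
  proof (cases "u = 0")
    case False
    then have "(u powr r) powr (1 / r) * (c powr r) powr (1 - 1 / r)
        \<le> 1 / r * u powr r + (1 - 1 / r) * c powr r"
      using assms real by (intro Youngs_inequality_0) auto
    moreover have "(u powr r) powr (1 / r) = u" "r * (1 - 1 / r) = r - 1"
      using assms real False by (auto simp: powr_powr field_simps)
    ultimately have "u * c powr (r - 1) \<le> 1 / r * u powr r + (1 - 1 / r) * c powr r"
      by (simp add: powr_powr)
    then have "r * (u * c powr (r - 1)) \<le> r * (1 / r * u powr r + (1 - 1 / r) * c powr r)"
      using assms by (intro mult_left_mono) auto
    moreover have "r * (1 / r * u powr r + (1 - 1 / r) * c powr r) = u powr r + (r - 1) * c powr r"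
      using assms by (simp add: field_simps)
    ultimately show ?thesis by (simp add: ac_simps)
  qed (use assms in auto)
  then have "ennreal (r * c powr (r - 1) * u) \<le> ennreal (u powr r + (r - 1) * c powr r)"
    by (rule ennreal_leI)
  then show ?thesis using real assms by (simp add: epowr_ennreal ennreal_mult)
qed simp

text \<open>
  Jensen's inequality for a measure of mass at most \<open>m\<close>: integrate the tangent inequality, taken at
  the integral of \<open>h\<close> divided by \<open>m\<close>.
\<close>

lemma jensen_epowr:
  assumes [measurable]: "h \<in> borel_measurable N"
    and m: "emeasure N (space N) \<le> ennreal m" "0 < m" and "1 \<le> r"
  shows "epowr (\<integral>\<^sup>+ x. h x \<partial>N) r \<le> ennreal (m powr (r - 1)) * (\<integral>\<^sup>+ x. epowr (h x) r \<partial>N)"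
proof -
  let ?J = "\<integral>\<^sup>+ x. epowr (h x) r \<partial>N"
  have tangent: "ennreal (r * c powr (r - 1)) * (\<integral>\<^sup>+ x. h x \<partial>N) \<le> ?J + ennreal ((r - 1) * c powr r * m)"
    if "0 < c" for c
  proof -
    have "ennreal (r * c powr (r - 1)) * (\<integral>\<^sup>+ x. h x \<partial>N) = (\<integral>\<^sup>+ x. ennreal (r * c powr (r - 1)) * h x \<partial>N)"
      by (simp add: nn_integral_cmult)
    also have "\<dots> \<le> (\<integral>\<^sup>+ x. epowr (h x) r + ennreal ((r - 1) * c powr r) \<partial>N)"
      by (intro nn_integral_mono epowr_tangent assms that)
    also have "\<dots> = ?J + ennreal ((r - 1) * c powr r) * emeasure N (space N)"
      by (subst nn_integral_add) (auto intro!: measurable_compose[OF assms(1) measurable_epowr])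
    also have "\<dots> \<le> ?J + ennreal ((r - 1) * c powr r) * ennreal m"
      by (intro add_left_mono mult_left_mono m) auto
    finally show ?thesis using assms by (simp add: ennreal_mult)
  qed
  show ?thesis
  proof (cases "?J = top")
    case True
    then show ?thesis using m by (simp add: ennreal_mult_top)
  next
    case False
    then obtain j where j: "?J = ennreal j" "0 \<le> j"
      by (cases ?J) auto
    have "(\<integral>\<^sup>+ x. h x \<partial>N) \<noteq> top"
    proof
      assume "(\<integral>\<^sup>+ x. h x \<partial>N) = top"
      with tangent[of 1] j assms show False
        by (auto simp: ennreal_mult_top top_unique simp flip: ennreal_plus)
    qed
    then obtain i where i: "(\<integral>\<^sup>+ x. h x \<partial>N) = ennreal i" "0 \<le> i"
      by (cases "\<integral>\<^sup>+ x. h x \<partial>N") auto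
    have "i powr r \<le> m powr (r - 1) * j"
    proof (cases "i = 0")
      case False
      define c where "c = i / m"
      have c: "0 < c" "i = c * m" using False i m by (auto simp: c_def)
      have "ennreal (r * c powr (r - 1) * i) \<le> ennreal (j + (r - 1) * c powr r * m)"
        using tangent[of c] i j c m \<open>1 \<le> r\<close> by (simp add: ennreal_mult ennreal_plus)
      then have *: "r * c powr (r - 1) * i \<le> j + (r - 1) * c powr r * m"
        using j m \<open>1 \<le> r\<close> by (subst (asm) ennreal_le_iff) auto
      have "c powr (r - 1) * c = c powr r"
        using c(1) by (simp add: powr_diff)
      then have "r * c powr (r - 1) * i = r * (c powr r * m)"
        unfolding c(2) by (metis mult.assoc)
      moreover have "(r - 1) * c powr r * m = r * (c powr r * m) - c powr r * m"
        by (simp add: algebra_simps)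
      ultimately have "c powr r * m \<le> j"
        using * by linarith
      then have "m powr (r - 1) * (c powr r * m) \<le> m powr (r - 1) * j"
        by (intro mult_left_mono) auto
      moreover have "m powr (r - 1) * (c powr r * m) = i powr r"
        using c m by (simp add: powr_mult powr_diff)
      ultimately show ?thesis by simp
    qed (use j in auto)
    then have "ennreal (i powr r) \<le> ennreal (m powr (r - 1) * j)" by (rule ennreal_leI)
    then show ?thesis using i j by (simp add: epowr_ennreal ennreal_mult)
  qed
qed

text \<open>
  Write \<open>\<delta> = \<beta> - \<eta>\<close>. The weight of the inner integral factors as
  \<open>(1 - ln x) powr (\<delta> - 1) / x\<close> times \<open>(1 - ln x) powr \<eta>\<close>, and the first factor has mass at most
  \<open>(1 - ln t) powr \<delta> / \<delta>\<close> on \<open>{t<..<1}\<close>. Jensen's inequality for that mass moves the power \<open>r\<close> inside,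
  and after Fubini the integral in \<open>t\<close> converges at \<open>0\<close> with exponent \<open>- \<delta> - 1\<close>,
  whatever the value of \<open>r\<close>.
\<close>

lemma hardy_log_powr:
  fixes \<Psi> :: "real \<Rightarrow> ennreal"
  assumes [measurable]: "\<Psi> \<in> borel_measurable borel" and "\<eta> < \<beta>" "1 \<le> r"
  shows "(\<integral>\<^sup>+ t\<in>{0<..<1}. ennreal ((1 - ln t) powr (r * (\<eta> - \<beta>) - 1) / t)
            * epowr (\<integral>\<^sup>+ x\<in>{t<..<1}. ennreal ((1 - ln x) powr (\<beta> - 1) / x) * \<Psi> x \<partial>lborel) r \<partial>lborel)
       \<le> ennreal ((\<beta> - \<eta>) powr (- r))
          * (\<integral>\<^sup>+ t\<in>{0<..<1}. ennreal ((1 - ln t) powr (r * \<eta> - 1) / t) * epowr (\<Psi> t) r \<partial>lborel)"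
proof -
  define \<delta> where "\<delta> = \<beta> - \<eta>"
  have "0 < \<delta>" using assms by (simp add: \<delta>_def)
  note [measurable] = measurable_compose[OF assms(1) measurable_epowr]
  define l where "l = (\<lambda>t::real. 1 - ln t)"
  have [measurable]: "l \<in> borel_measurable borel" unfolding l_def by measurable
  have l: "1 < l t" if "0 < t" "t < 1" for t using that by (simp add: l_def)
  define w where "w = (\<lambda>x. ennreal (l x powr (\<delta> - 1) / x))"
  have [measurable]: "w \<in> borel_measurable borel" unfolding w_def by measurable
  have w_mult: "w x * ennreal (l x powr a) = ennreal (l x powr (a + \<delta> - 1) / x)" if "0 < x" for x a
  proof -
    have "l x powr (\<delta> - 1) / x * l x powr a = l x powr (a + \<delta> - 1) / x"
      by (simp add: powr_add[symmetric] algebra_simps)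
    then show ?thesis using that by (simp add: w_def flip: ennreal_mult)
  qed
  have inner: "epowr (\<integral>\<^sup>+ x\<in>{t<..<1}. ennreal (l x powr (\<beta> - 1) / x) * \<Psi> x \<partial>lborel) r
      \<le> ennreal ((l t powr \<delta> / \<delta>) powr (r - 1))
        * (\<integral>\<^sup>+ x\<in>{t<..<1}. ennreal (l x powr (r * \<eta> + \<delta> - 1) / x) * epowr (\<Psi> x) r \<partial>lborel)"
    if t: "0 < t" "t < 1" for t
  proof -
    define N where "N = density lborel (\<lambda>x. w x * indicator {t<..<1} x)"
    have N: "(\<integral>\<^sup>+ x. F x \<partial>N) = (\<integral>\<^sup>+ x\<in>{t<..<1}. w x * F x \<partial>lborel)"
      if [measurable]: "F \<in> borel_measurable borel" for F
      unfolding N_def by (subst nn_integral_density) (auto intro!: nn_integral_cong simp: ac_simps)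
    have meas: "F \<in> borel_measurable N \<longleftrightarrow> F \<in> borel_measurable borel" for F :: "real \<Rightarrow> ennreal"
      by (simp add: N_def)
    have "(\<integral>\<^sup>+ x\<in>{t<..<1}. ennreal (l x powr (\<beta> - 1) / x) * \<Psi> x \<partial>lborel)
        = (\<integral>\<^sup>+ x. ennreal (l x powr \<eta>) * \<Psi> x \<partial>N)"
    proof (subst N)
      show "(\<integral>\<^sup>+ x\<in>{t<..<1}. ennreal (l x powr (\<beta> - 1) / x) * \<Psi> x \<partial>lborel)
          = (\<integral>\<^sup>+ x\<in>{t<..<1}. w x * (ennreal (l x powr \<eta>) * \<Psi> x) \<partial>lborel)"
        using t w_mult[of _ \<eta>]
        by (intro nn_integral_cong) (auto simp: indicator_def \<delta>_def mult.assoc[symmetric])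
    qed measurable
    also have "epowr \<dots> r \<le> ennreal ((l t powr \<delta> / \<delta>) powr (r - 1))
        * (\<integral>\<^sup>+ x. epowr (ennreal (l x powr \<eta>) * \<Psi> x) r \<partial>N)"
    proof (rule jensen_epowr)
      have "emeasure N (space N) = (\<integral>\<^sup>+ x. 1 \<partial>N)" by simp
      also have "\<dots> = (\<integral>\<^sup>+ x\<in>{t<..<1}. ennreal ((1 - ln x) powr (\<delta> - 1) / x) \<partial>lborel)"
        by (subst N) (auto simp: w_def l_def)
      also have "\<dots> \<le> ennreal (l t powr \<delta> / \<delta>)"
        unfolding l_def using \<open>0 < \<delta>\<close> t by (rule nn_integral_log_powr_above)
      finally show "emeasure N (space N) \<le> ennreal (l t powr \<delta> / \<delta>)" .
    qed (use \<open>0 < \<delta>\<close> l[OF t] \<open>1 \<le> r\<close> meas in auto)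
    also have "(\<integral>\<^sup>+ x. epowr (ennreal (l x powr \<eta>) * \<Psi> x) r \<partial>N)
        = (\<integral>\<^sup>+ x\<in>{t<..<1}. ennreal (l x powr (r * \<eta> + \<delta> - 1) / x) * epowr (\<Psi> x) r \<partial>lborel)"
    proof (subst N)
      show "(\<integral>\<^sup>+ x\<in>{t<..<1}. w x * epowr (ennreal (l x powr \<eta>) * \<Psi> x) r \<partial>lborel)
          = (\<integral>\<^sup>+ x\<in>{t<..<1}. ennreal (l x powr (r * \<eta> + \<delta> - 1) / x) * epowr (\<Psi> x) r \<partial>lborel)"
        using t \<open>1 \<le> r\<close> w_mult[of _ "r * \<eta>"]
        by (intro nn_integral_cong)
           (auto simp: indicator_def epowr_mult epowr_ennreal powr_powr mult.assoc[symmetric]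
              mult.commute[of \<eta> r])
    qed measurable
    finally show ?thesis .
  qed
  define B where "B = (\<lambda>x. ennreal (l x powr (r * \<eta> + \<delta> - 1) / x) * epowr (\<Psi> x) r)"
  have [measurable]: "B \<in> borel_measurable borel" unfolding B_def by measurable
  define A where "A = (\<lambda>t. ennreal (l t powr (- \<delta> - 1) / t))"
  have [measurable]: "A \<in> borel_measurable borel" unfolding A_def by measurable
  define D where "D = ennreal (\<delta> powr (1 - r))"
  have "(\<integral>\<^sup>+ t\<in>{0<..<1}. ennreal (l t powr (r * (\<eta> - \<beta>) - 1) / t)
          * epowr (\<integral>\<^sup>+ x\<in>{t<..<1}. ennreal (l x powr (\<beta> - 1) / x) * \<Psi> x \<partial>lborel) r \<partial>lborel)
     \<le> (\<integral>\<^sup>+ t\<in>{0<..<1}. D * A t * (\<integral>\<^sup>+ x\<in>{t<..<1}. B x \<partial>lborel) \<partial>lborel)"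
  proof (intro nn_integral_mono)
    fix t :: real
    show "ennreal (l t powr (r * (\<eta> - \<beta>) - 1) / t)
          * epowr (\<integral>\<^sup>+ x\<in>{t<..<1}. ennreal (l x powr (\<beta> - 1) / x) * \<Psi> x \<partial>lborel) r * indicator {0<..<1} t
       \<le> D * A t * (\<integral>\<^sup>+ x\<in>{t<..<1}. B x \<partial>lborel) * indicator {0<..<1} t"
    proof (cases "t \<in> {0<..<1}")
      case True
      then have t: "0 < t" "t < 1" by auto
      have "l t powr (r * (\<eta> - \<beta>) - 1) / t * ((l t powr \<delta> / \<delta>) powr (r - 1))
          = \<delta> powr (1 - r) * (l t powr (- \<delta> - 1) / t)"
      proof -
        have "(l t powr \<delta> / \<delta>) powr (r - 1) = l t powr (\<delta> * (r - 1)) * \<delta> powr (1 - r)"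
          using \<open>0 < \<delta>\<close> l[OF t] powr_minus_divide[of \<delta> "r - 1"] by (simp add: powr_divide powr_powr)
        moreover have "l t powr (r * (\<eta> - \<beta>) - 1) * l t powr (\<delta> * (r - 1)) = l t powr (- \<delta> - 1)"
          unfolding powr_add[symmetric] by (simp add: \<delta>_def algebra_simps)
        ultimately show ?thesis by (simp add: field_simps)
      qed
      then have "ennreal (l t powr (r * (\<eta> - \<beta>) - 1) / t) * ennreal ((l t powr \<delta> / \<delta>) powr (r - 1))
          = D * A t"
        using t by (simp add: D_def A_def flip: ennreal_mult)
      with mult_left_mono[OF inner[OF t], of "ennreal (l t powr (r * (\<eta> - \<beta>) - 1) / t)"] True
      show ?thesis by (simp add: B_def mult.assoc[symmetric])
    qed simp
  qed
  also have "\<dots> = (\<integral>\<^sup>+ t. \<integral>\<^sup>+ x. D * A t * B x * (if 0 < t \<and> t < x \<and> x < 1 then 1 else 0) \<partial>lborel \<partial>lborel)"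
  proof (intro nn_integral_cong)
    fix t :: real
    have "D * A t * (\<integral>\<^sup>+ x\<in>{t<..<1}. B x \<partial>lborel) * indicator {0<..<1} t
        = (D * A t * indicator {0<..<1} t) * (\<integral>\<^sup>+ x\<in>{t<..<1}. B x \<partial>lborel)" by (simp add: ac_simps)
    also have "\<dots> = (\<integral>\<^sup>+ x. (D * A t * indicator {0<..<1} t) * (B x * indicator {t<..<1} x) \<partial>lborel)"
      by (intro nn_integral_cmult[symmetric]) measurable
    also have "\<dots> = (\<integral>\<^sup>+ x. D * A t * B x * (if 0 < t \<and> t < x \<and> x < 1 then 1 else 0) \<partial>lborel)"
      by (intro nn_integral_cong) (auto simp: indicator_def mult.assoc)
    finally show "D * A t * (\<integral>\<^sup>+ x\<in>{t<..<1}. B x \<partial>lborel) * indicator {0<..<1} t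
        = (\<integral>\<^sup>+ x. D * A t * B x * (if 0 < t \<and> t < x \<and> x < 1 then 1 else 0) \<partial>lborel)" .
  qed
  also have "\<dots> = (\<integral>\<^sup>+ x. \<integral>\<^sup>+ t. D * A t * B x * (if 0 < t \<and> t < x \<and> x < 1 then 1 else 0) \<partial>lborel \<partial>lborel)"
    by (rule lborel_pair.Fubini') measurable
  also have "\<dots> = (\<integral>\<^sup>+ x. ennreal (\<delta> powr (- r))
      * (ennreal (l x powr (r * \<eta> - 1) / x) * epowr (\<Psi> x) r * indicator {0<..<1} x) \<partial>lborel)"
  proof (intro nn_integral_cong)
    fix x :: real
    show "(\<integral>\<^sup>+ t. D * A t * B x * (if 0 < t \<and> t < x \<and> x < 1 then 1 else 0) \<partial>lborel)
        = ennreal (\<delta> powr (- r)) * (ennreal (l x powr (r * \<eta> - 1) / x) * epowr (\<Psi> x) r * indicator {0<..<1} x)"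
    proof (cases "0 < x \<and> x < 1")
      case True
      have "(\<integral>\<^sup>+ t. D * A t * B x * (if 0 < t \<and> t < x \<and> x < 1 then 1 else 0) \<partial>lborel)
          = (\<integral>\<^sup>+ t. D * B x * (A t * indicator {0<..<x} t) \<partial>lborel)"
        using True by (intro nn_integral_cong) (auto simp: indicator_def ac_simps)
      also have "\<dots> = D * B x * (\<integral>\<^sup>+ t\<in>{0<..<x}. A t \<partial>lborel)"
        by (intro nn_integral_cmult) measurable
      also have "(\<integral>\<^sup>+ t\<in>{0<..<x}. A t \<partial>lborel) = ennreal (l x powr (- \<delta>) / \<delta>)"
        unfolding A_def l_def using True \<open>0 < \<delta>\<close> by (intro nn_integral_log_powr_below) auto
      also have "D * B x * ennreal (l x powr (- \<delta>) / \<delta>)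
          = ennreal (\<delta> powr (1 - r) * (l x powr (r * \<eta> + \<delta> - 1) / x) * (l x powr (- \<delta>) / \<delta>)) * epowr (\<Psi> x) r"
        using True \<open>0 < \<delta>\<close> unfolding D_def B_def
          by (subst (2) mult.commute, subst ennreal_mult, simp, simp, subst ennreal_mult) (simp_all add: ac_simps)
      also have "\<delta> powr (1 - r) * (l x powr (r * \<eta> + \<delta> - 1) / x) * (l x powr (- \<delta>) / \<delta>)
          = \<delta> powr (- r) * (l x powr (r * \<eta> - 1) / x)"
      proof -
        have "l x powr (r * \<eta> + \<delta> - 1) * l x powr (- \<delta>) = l x powr (r * \<eta> - 1)"
          unfolding powr_add[symmetric] by simp
        moreover have "\<delta> powr (1 - r) = \<delta> powr (- r) * \<delta>"
          using \<open>0 < \<delta>\<close> by (simp add: powr_diff powr_minus field_simps)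
        ultimately show ?thesis using \<open>0 < \<delta>\<close> by (simp add: field_simps)
      qed
      also have "ennreal (\<delta> powr (- r) * (l x powr (r * \<eta> - 1) / x)) * epowr (\<Psi> x) r
          = ennreal (\<delta> powr (- r)) * (ennreal (l x powr (r * \<eta> - 1) / x) * epowr (\<Psi> x) r)"
        using True by (subst ennreal_mult) (auto simp: mult.assoc)
      finally show ?thesis using True by simp
    next
      case False
      then have "(\<integral>\<^sup>+ t. D * A t * B x * (if 0 < t \<and> t < x \<and> x < 1 then 1 else 0) \<partial>lborel)
          = (\<integral>\<^sup>+ t. 0 \<partial>(lborel :: real measure))"
        by (intro nn_integral_cong) auto
      with False show ?thesis by (auto simp: indicator_def)
    qed
  qed
  also have "\<dots> = ennreal (\<delta> powr (- r))
      * (\<integral>\<^sup>+ x\<in>{0<..<1}. ennreal (l x powr (r * \<eta> - 1) / x) * epowr (\<Psi> x) r \<partial>lborel)"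
    by (intro nn_integral_cmult) measurable
  finally show ?thesis by (simp add: l_def \<delta>_def)
qed

section \<open>Decreasing rearrangements on a probability space\<close>

lemma distribution_function_vanishes:
  fixes f :: "'a \<Rightarrow> real"
  assumes "emeasure M (space M) = 1" "f \<in> borel_measurable M" "0 < s"
  shows "\<exists>t\<ge>0. emeasure M {x \<in> space M. \<bar>f x\<bar> > t} \<le> ennreal s"
proof -
  have [measurable]: "f \<in> borel_measurable M" by fact
  have "(\<lambda>k. emeasure M {x \<in> space M. \<bar>f x\<bar> > real k}) \<longlonglongrightarrow> emeasure M (\<Inter>k. {x \<in> space M. \<bar>f x\<bar> > real k})"
  proof (rule Lim_emeasure_decseq)
    fix k
    have "emeasure M {x \<in> space M. \<bar>f x\<bar> > real k} \<le> emeasure M (space M)"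
      by (intro emeasure_mono) auto
    then show "emeasure M {x \<in> space M. \<bar>f x\<bar> > real k} \<noteq> \<infinity>"
      using assms by (auto simp: top_unique)
  qed (auto simp: decseq_def)
  moreover have "(\<Inter>k. {x \<in> space M. \<bar>f x\<bar> > real k}) = {}"
  proof safe
    fix x assume "x \<in> (\<Inter>k. {x \<in> space M. \<bar>f x\<bar> > real k})"
    moreover obtain k where "\<bar>f x\<bar> < real k" using reals_Archimedean2 by blast
    ultimately have "\<bar>f x\<bar> > real k" by blast
    with \<open>\<bar>f x\<bar> < real k\<close> show "x \<in> {}" by simp
  qed
  ultimately have "(\<lambda>k. emeasure M {x \<in> space M. \<bar>f x\<bar> > real k}) \<longlonglongrightarrow> 0" by simp
  then have "eventually (\<lambda>k. emeasure M {x \<in> space M. \<bar>f x\<bar> > real k} < ennreal s) sequentially"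
    using \<open>0 < s\<close> by (intro order_tendstoD) auto
  then obtain k where "emeasure M {x \<in> space M. \<bar>f x\<bar> > real k} < ennreal s"
    by (auto simp: eventually_sequentially)
  then show ?thesis
    by (intro exI[of _ "real k"]) auto
qed

text \<open>
  The rearrangement is a right-continuous inverse of the distribution function: the infimum that
  defines it is attained, because the sets \<open>\<bar>f\<bar> > t + 1 / (k + 1)\<close> increase to \<open>\<bar>f\<bar> > t\<close>. The
  estimates for rearrangements below are read off from this equivalence.
\<close>

lemma decr_rearr_le_iff:
  assumes "emeasure M (space M) = 1" "f \<in> borel_measurable M" "0 < s" "0 \<le> t"
  shows "decr_rearr M f s \<le> t \<longleftrightarrow> emeasure M {x \<in> space M. \<bar>f x\<bar> > t} \<le> ennreal s"
proof -
  have [measurable]: "f \<in> borel_measurable M" by fact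
  define T where "T = {t. 0 \<le> t \<and> emeasure M {x \<in> space M. \<bar>f x\<bar> > t} \<le> ennreal s}"
  have T: "T \<noteq> {}" "bdd_below T"
    using distribution_function_vanishes[OF assms(1-3)] by (auto simp: T_def intro: bdd_belowI)
  have up: "t' \<in> T" if "t \<in> T" "t \<le> t'" for t t'
  proof -
    have "emeasure M {x \<in> space M. \<bar>f x\<bar> > t'} \<le> emeasure M {x \<in> space M. \<bar>f x\<bar> > t}"
      using that by (intro emeasure_mono) auto
    then show ?thesis using that by (auto simp: T_def)
  qed
  have "t \<in> T" if "Inf T \<le> t"
  proof -
    have "emeasure M {x \<in> space M. \<bar>f x\<bar> > t + 1 / real (k + 1)} \<le> ennreal s" for k
    proof -
      have "Inf T < t + 1 / real (k + 1)"
        using that by (rule le_less_trans) simp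
      then obtain u where "u \<in> T" "u < t + 1 / real (k + 1)"
        using cInf_lessD[OF T(1)] by blast
      then show ?thesis using up[of u "t + 1 / real (k + 1)"] by (auto simp: T_def)
    qed
    moreover have "emeasure M {x \<in> space M. \<bar>f x\<bar> > t}
        = (SUP k. emeasure M {x \<in> space M. \<bar>f x\<bar> > t + 1 / real (k + 1)})"
    proof -
      have "{x \<in> space M. \<bar>f x\<bar> > t} = (\<Union>k. {x \<in> space M. \<bar>f x\<bar> > t + 1 / real (k + 1)})"
      proof safe
        fix x assume "\<bar>f x\<bar> > t"
        then obtain k where "inverse (real (Suc k)) < \<bar>f x\<bar> - t"
          using reals_Archimedean[of "\<bar>f x\<bar> - t"] by auto
        moreover assume "x \<in> space M"
        ultimately show "x \<in> (\<Union>k. {x \<in> space M. \<bar>f x\<bar> > t + 1 / real (k + 1)})"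
          by (auto intro!: exI[of _ k] simp: inverse_eq_divide)
      next
        fix x k assume "t + 1 / real (k + 1) < \<bar>f x\<bar>"
        then show "t < \<bar>f x\<bar>" by (smt (verit) divide_nonneg_nonneg of_nat_0_le_iff)
      qed
      moreover have "incseq (\<lambda>k. {x \<in> space M. \<bar>f x\<bar> > t + 1 / real (k + 1)})"
      proof (rule incseq_SucI)
        fix k :: nat
        have "1 / real (Suc k + 1) \<le> 1 / real (k + 1)" by (intro divide_left_mono) auto
        then show "{x \<in> space M. \<bar>f x\<bar> > t + 1 / real (k + 1)}
            \<subseteq> {x \<in> space M. \<bar>f x\<bar> > t + 1 / real (Suc k + 1)}"
          by (smt (verit) Collect_mono)
      qed
      ultimately show ?thesis
        by (subst SUP_emeasure_incseq) auto
    qed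
    ultimately show ?thesis using \<open>0 \<le> t\<close> by (auto simp: T_def intro: SUP_least)
  qed
  then show ?thesis
    using \<open>0 \<le> t\<close> unfolding decr_rearr_def T_def[symmetric]
    using cInf_lower[OF _ T(2), of t] by (auto simp: T_def)
qed

lemma decr_rearr_ge_0:
  assumes "emeasure M (space M) = 1" "f \<in> borel_measurable M" "0 < s"
  shows "0 \<le> decr_rearr M f s"
  using distribution_function_vanishes[OF assms] unfolding decr_rearr_def by (intro cInf_greatest) auto

lemma decr_rearr_antimono:
  assumes "emeasure M (space M) = 1" "f \<in> borel_measurable M" "0 < s" "s \<le> s'"
  shows "decr_rearr M f s' \<le> decr_rearr M f s"
proof -
  have "emeasure M {x \<in> space M. \<bar>f x\<bar> > decr_rearr M f s} \<le> ennreal s"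
    using decr_rearr_le_iff[OF assms(1-3) decr_rearr_ge_0[OF assms(1-3)]] by simp
  also have "\<dots> \<le> ennreal s'" using assms by (intro ennreal_leI)
  finally show ?thesis
    using assms decr_rearr_ge_0[OF assms(1-3)] by (subst decr_rearr_le_iff) auto
qed

text \<open>
  Monotone on the positive half-line; at arguments \<open>s \<le> 0\<close>, where \<open>ennreal s = 0\<close>, it is
  constant.
\<close>

lemma borel_measurable_decr_rearr:
  assumes "emeasure M (space M) = 1" "f \<in> borel_measurable M"
  shows "decr_rearr M f \<in> borel_measurable borel"
proof -
  have "mono_on {s. 0 < s} (\<lambda>s. - decr_rearr M f s)"
    by (rule mono_onI) (simp add: decr_rearr_antimono[OF assms])
  from borel_measurable_uminus[OF borel_measurable_mono_on_fnc[OF this]]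
  have 1: "decr_rearr M f \<in> borel_measurable (restrict_space borel {s. 0 < s})"
    by simp
  have eq0: "decr_rearr M f s = decr_rearr M f 0" if "s \<le> 0" for s
    using that by (simp add: decr_rearr_def ennreal_neg)
  have "(\<lambda>s. if 0 < s then decr_rearr M f s else decr_rearr M f 0) = decr_rearr M f"
  proof
    fix s show "(if 0 < s then decr_rearr M f s else decr_rearr M f 0) = decr_rearr M f s"
      using eq0[of s] by (cases "0 < s") simp_all
  qed
  moreover have "(\<lambda>s. if 0 < s then decr_rearr M f s else decr_rearr M f 0) \<in> borel_measurable borel"
    by (intro measurable_If_restrict_space_iff[THEN iffD2] conjI 1) auto
  ultimately show ?thesis by simp
qed

text \<open>
  Equimeasurability: the laws of \<open>\<bar>f\<bar>\<close> and of its rearrangement on \<open>{0<..<1}\<close> agree on all rays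
  \<open>{t<..}\<close>.
\<close>

lemma nn_integral_decr_rearr:
  assumes M: "emeasure M (space M) = 1" and f: "f \<in> borel_measurable M"
    and [measurable]: "h \<in> borel_measurable borel"
  shows "(\<integral>\<^sup>+ x. h \<bar>f x\<bar> \<partial>M) = (\<integral>\<^sup>+ s\<in>{0<..<1}. h (decr_rearr M f s) \<partial>lborel)"
proof -
  have [measurable]: "f \<in> borel_measurable M" by fact
  define N where "N = restrict_space lborel {0<..<1::real}"
  note [measurable] = borel_measurable_decr_rearr[OF M f]
  have mN [measurable]: "decr_rearr M f \<in> borel_measurable N"
    unfolding N_def by (intro measurable_restrict_space1) simp
  have "distr M borel (\<lambda>x. \<bar>f x\<bar>) = distr N borel (decr_rearr M f)"
  proof (rule measure_eqI_lessThan)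
    fix t :: real
    have L: "emeasure (distr M borel (\<lambda>x. \<bar>f x\<bar>)) {t<..} = emeasure M {x \<in> space M. \<bar>f x\<bar> > t}"
      by (subst emeasure_distr) (auto intro!: arg_cong[where f="emeasure M"])
    have le1: "emeasure M {x \<in> space M. \<bar>f x\<bar> > t} \<le> 1"
      using emeasure_mono[of "{x \<in> space M. \<bar>f x\<bar> > t}" "space M" M] M by auto
    then show "emeasure (distr M borel (\<lambda>x. \<bar>f x\<bar>)) {t<..} < \<infinity>"
      unfolding L by (auto simp: less_top top_unique intro: le_less_trans)
    have R: "emeasure (distr N borel (decr_rearr M f)) {t<..} = emeasure lborel {s. 0 < s \<and> s < 1 \<and> decr_rearr M f s > t}"
      by (subst emeasure_distr, simp, simp, subst N_def, subst emeasure_restrict_space)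
         (auto simp: N_def space_restrict_space intro!: arg_cong[where f="emeasure lborel"])
    obtain m where m: "emeasure M {x \<in> space M. \<bar>f x\<bar> > t} = ennreal m" "0 \<le> m" "m \<le> 1"
      using le1 by (cases "emeasure M {x \<in> space M. \<bar>f x\<bar> > t}") (auto simp: top_unique)
    have "emeasure lborel {s. 0 < s \<and> s < 1 \<and> decr_rearr M f s > t} = ennreal m"
    proof (cases "0 \<le> t")
      case True
      have "{s. 0 < s \<and> s < 1 \<and> decr_rearr M f s > t} = {0<..<m}"
        using decr_rearr_le_iff[OF M f _ True] m by (auto simp: not_le[symmetric])
      then show ?thesis using m by simp
    next
      case False
      then have "{x \<in> space M. \<bar>f x\<bar> > t} = space M" by auto
      moreover have "{s. 0 < s \<and> s < 1 \<and> decr_rearr M f s > t} = {0<..<1}"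
        using decr_rearr_ge_0[OF M f] False by (auto intro: less_le_trans[of t 0])
      ultimately show ?thesis using M m by simp
    qed
    then show "emeasure (distr M borel (\<lambda>x. \<bar>f x\<bar>)) {t<..} = emeasure (distr N borel (decr_rearr M f)) {t<..}"
      using L R m by simp
  qed auto
  then have "(\<integral>\<^sup>+ y. h y \<partial>distr M borel (\<lambda>x. \<bar>f x\<bar>)) = (\<integral>\<^sup>+ y. h y \<partial>distr N borel (decr_rearr M f))"
    by simp
  then show ?thesis
    by (simp add: nn_integral_distr) (simp add: N_def nn_integral_restrict_space)
qed

text \<open>
  Where \<open>\<bar>f\<bar>\<close> exceeds the right-hand side, \<open>g\<close> or \<open>k\<close> exceeds its own rearrangement at \<open>s\<close>; each of
  these events has measure at most \<open>s\<close>, which accounts for the doubled argument.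
\<close>

lemma decr_rearr_add_le:
  assumes M: "emeasure M (space M) = 1"
    and [measurable]: "f \<in> borel_measurable M" "g \<in> borel_measurable M" "k \<in> borel_measurable M"
    and "AE x in M. f x = g x + k x" "0 < s"
  shows "decr_rearr M f (2 * s) \<le> decr_rearr M g s + decr_rearr M k s"
proof -
  let ?a = "decr_rearr M g s" and ?b = "decr_rearr M k s"
  have ab: "0 \<le> ?a" "0 \<le> ?b" using assms by (auto intro: decr_rearr_ge_0)
  have "emeasure M {x \<in> space M. \<bar>f x\<bar> > ?a + ?b}
      \<le> emeasure M ({x \<in> space M. \<bar>g x\<bar> > ?a} \<union> {x \<in> space M. \<bar>k x\<bar> > ?b})"
    using assms(5) by (intro emeasure_mono_AE) (auto elim!: eventually_mono)
  also have "\<dots> \<le> emeasure M {x \<in> space M. \<bar>g x\<bar> > ?a} + emeasure M {x \<in> space M. \<bar>k x\<bar> > ?b}"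
    by (intro emeasure_subadditive) auto
  also have "\<dots> \<le> ennreal s + ennreal s"
    using ab assms by (intro add_mono) (auto simp: decr_rearr_le_iff[symmetric])
  also have "\<dots> = ennreal (2 * s)" using \<open>0 < s\<close> by (simp flip: ennreal_plus)
  finally show ?thesis using assms ab by (subst decr_rearr_le_iff) auto
qed

lemma decr_rearr_mono:
  assumes "emeasure M (space M) = 1" "f \<in> borel_measurable M" "g \<in> borel_measurable M"
    and "\<And>x. x \<in> space M \<Longrightarrow> \<bar>g x\<bar> \<le> \<bar>f x\<bar>" "0 < s"
  shows "decr_rearr M g s \<le> decr_rearr M f s"
proof -
  have [measurable]: "f \<in> borel_measurable M" "g \<in> borel_measurable M" by fact+
  note nn = decr_rearr_ge_0[OF assms(1,2,5)]
  have "emeasure M {x \<in> space M. \<bar>g x\<bar> > decr_rearr M f s} \<le> emeasure M {x \<in> space M. \<bar>f x\<bar> > decr_rearr M f s}"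
    using assms(4) by (intro emeasure_mono) (auto intro: less_le_trans)
  also have "\<dots> \<le> ennreal s"
    using decr_rearr_le_iff[OF assms(1,2,5) nn] by simp
  finally show ?thesis using assms nn by (subst decr_rearr_le_iff) auto
qed

lemma decr_rearr_le_bound:
  assumes "emeasure M (space M) = 1" "f \<in> borel_measurable M"
    and "\<And>x. x \<in> space M \<Longrightarrow> \<bar>f x\<bar> \<le> a" "0 \<le> a" "0 < s"
  shows "decr_rearr M f s \<le> a"
proof -
  have "{x \<in> space M. \<bar>f x\<bar> > a} = {}" using assms(3) by force
  then have "emeasure M {x \<in> space M. \<bar>f x\<bar> > a} \<le> ennreal s" by (simp only: emeasure_empty) simp
  then show ?thesis using assms by (subst decr_rearr_le_iff) auto
qed

section \<open>Norms of the largest values of a function\<close>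

text \<open>
  The \<open>L\<^sup>p\<close> norm of the rearrangement over \<open>{0<..<t}\<close>, that is, of the part of \<open>f\<close> with the largest
  values. The norms of \<open>L\<^sup>p\<close>, of the small Lebesgue space and of the Gamma space depend on \<open>f\<close>
  through this function only.
\<close>

definition head_norm :: "'a measure \<Rightarrow> real \<Rightarrow> ('a \<Rightarrow> real) \<Rightarrow> real \<Rightarrow> ennreal" where
  "head_norm M p f t = epowr (\<integral>\<^sup>+ \<sigma>\<in>{0<..<t}. ennreal (decr_rearr M f \<sigma> powr p) \<partial>lborel) (1 / p)"

lemma head_norm_mono: "s \<le> t \<Longrightarrow> 0 < p \<Longrightarrow> head_norm M p f s \<le> head_norm M p f t"
  unfolding head_norm_def
  by (intro epowr_mono nn_integral_mono mult_left_mono) (auto simp: indicator_def)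

lemma borel_measurable_head_norm:
  assumes "emeasure M (space M) = 1" "f \<in> borel_measurable M"
  shows "head_norm M p f \<in> borel_measurable borel"
proof -
  note [measurable] = borel_measurable_decr_rearr[OF assms]
  have "(\<lambda>t. \<integral>\<^sup>+ \<sigma>. ennreal (decr_rearr M f \<sigma> powr p) * (if 0 < \<sigma> \<and> \<sigma> < t then 1 else 0) \<partial>lborel)
      \<in> borel_measurable borel"
    by measurable
  moreover have "(if 0 < \<sigma> \<and> \<sigma> < t then 1 else 0) = (indicator {0<..<t} \<sigma> :: ennreal)" for \<sigma> t :: real
    by (auto simp: indicator_def)
  ultimately show ?thesis
    unfolding head_norm_def by (simp add: measurable_compose[OF _ measurable_epowr])
qed

lemma nn_integral_dilate:
  fixes h :: "real \<Rightarrow> ennreal"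
  assumes [measurable]: "h \<in> borel_measurable borel" and "0 < c"
  shows "(\<integral>\<^sup>+ x\<in>{0<..<c * t}. h x \<partial>lborel) = ennreal c * (\<integral>\<^sup>+ x\<in>{0<..<t}. h (c * x) \<partial>lborel)"
proof -
  have "(\<integral>\<^sup>+ x\<in>{0<..<c * t}. h x \<partial>lborel)
      = ennreal \<bar>c\<bar> * (\<integral>\<^sup>+ x. h (0 + c * x) * indicator {0<..<c * t} (0 + c * x) \<partial>lborel)"
    using \<open>0 < c\<close> by (intro nn_integral_real_affine) auto
  moreover have "indicator {0<..<c * t} (c * x) = (indicator {0<..<t} x :: ennreal)" for x
    using \<open>0 < c\<close> by (auto simp: indicator_def zero_less_mult_iff)
  ultimately show ?thesis using \<open>0 < c\<close> by simp
qed

text \<open>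
  The mean of a decreasing function over \<open>{0<..<t}\<close> decreases in \<open>t\<close>. Hence the head norm at one
  point controls it at every larger point.
\<close>

lemma head_norm_dilate_le:
  assumes M: "emeasure M (space M) = 1" and f: "f \<in> borel_measurable M" and "0 < p" "1 \<le> c"
  shows "head_norm M p f (c * t) \<le> ennreal (c powr (1 / p)) * head_norm M p f t"
proof -
  note [measurable] = borel_measurable_decr_rearr[OF M f]
  have "(\<integral>\<^sup>+ \<sigma>\<in>{0<..<c * t}. ennreal (decr_rearr M f \<sigma> powr p) \<partial>lborel)
      = ennreal c * (\<integral>\<^sup>+ \<sigma>\<in>{0<..<t}. ennreal (decr_rearr M f (c * \<sigma>) powr p) \<partial>lborel)"
    using \<open>1 \<le> c\<close> by (intro nn_integral_dilate) auto
  also have "\<dots> \<le> ennreal c * (\<integral>\<^sup>+ \<sigma>\<in>{0<..<t}. ennreal (decr_rearr M f \<sigma> powr p) \<partial>lborel)"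
  proof (intro mult_left_mono nn_integral_mono)
    fix \<sigma> :: real
    have "decr_rearr M f (c * \<sigma>) powr p \<le> decr_rearr M f \<sigma> powr p" if "0 < \<sigma>"
      using that assms mult_right_mono[of 1 c \<sigma>]
      by (intro powr_mono2 decr_rearr_antimono decr_rearr_ge_0) auto
    then show "ennreal (decr_rearr M f (c * \<sigma>) powr p) * indicator {0<..<t} \<sigma>
        \<le> ennreal (decr_rearr M f \<sigma> powr p) * indicator {0<..<t} \<sigma>"
      by (auto simp: indicator_def intro!: ennreal_leI)
  qed simp
  finally have "head_norm M p f (c * t)
      \<le> epowr (ennreal c * (\<integral>\<^sup>+ \<sigma>\<in>{0<..<t}. ennreal (decr_rearr M f \<sigma> powr p) \<partial>lborel)) (1 / p)"
    unfolding head_norm_def using \<open>0 < p\<close> by (intro epowr_mono) auto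
  then show ?thesis using \<open>1 \<le> c\<close> by (simp add: head_norm_def epowr_mult epowr_ennreal)
qed

text \<open>
  A dilation by \<open>2\<close> removes the doubled argument from the inequality for rearrangements of sums.
\<close>

lemma head_norm_add_le:
  assumes M: "emeasure M (space M) = 1"
    and f: "f \<in> borel_measurable M" and g: "g \<in> borel_measurable M" and k: "k \<in> borel_measurable M"
    and sum: "AE x in M. f x = g x + k x" and "0 < p"
  shows "head_norm M p f t \<le> ennreal (2 powr (1 + 2 / p)) * (head_norm M p g t + head_norm M p k t)"
proof (cases "0 < t")
  case False
  then show ?thesis by (simp add: head_norm_def)
next
  case True
  note [measurable] = borel_measurable_decr_rearr[OF M f] borel_measurable_decr_rearr[OF M g] borel_measurable_decr_rearr[OF M k]
  let ?P = "\<lambda>u t. \<integral>\<^sup>+ \<sigma>\<in>{0<..<t}. ennreal (decr_rearr M u \<sigma> powr p) \<partial>lborel"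
  have "?P f t = ennreal 2 * (\<integral>\<^sup>+ \<sigma>\<in>{0<..<t / 2}. ennreal (decr_rearr M f (2 * \<sigma>) powr p) \<partial>lborel)"
    using nn_integral_dilate[of "\<lambda>\<sigma>. ennreal (decr_rearr M f \<sigma> powr p)" 2 "t / 2"] by simp
  also have "\<dots> \<le> ennreal 2 * (\<integral>\<^sup>+ \<sigma>\<in>{0<..<t}. ennreal (2 powr p) *
        (ennreal (decr_rearr M g \<sigma> powr p) + ennreal (decr_rearr M k \<sigma> powr p)) \<partial>lborel)"
  proof (intro mult_left_mono nn_integral_mono)
    fix \<sigma> :: real
    let ?a = "decr_rearr M g \<sigma>" and ?b = "decr_rearr M k \<sigma>"
    have "ennreal (decr_rearr M f (2 * \<sigma>) powr p) \<le> ennreal (2 powr p) * (ennreal (?a powr p) + ennreal (?b powr p))"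
      if s: "0 < \<sigma>"
    proof -
      have ab: "0 \<le> ?a" "0 \<le> ?b" using decr_rearr_ge_0 M g k s by blast+
      have "decr_rearr M f (2 * \<sigma>) powr p \<le> (?a + ?b) powr p"
        using assms s by (intro powr_mono2 decr_rearr_add_le decr_rearr_ge_0) auto
      then have "ennreal (decr_rearr M f (2 * \<sigma>) powr p) \<le> epowr (ennreal ?a + ennreal ?b) p"
        using ab by (simp add: epowr_ennreal ennreal_leI flip: ennreal_plus)
      also have "\<dots> \<le> ennreal (2 powr p) * (epowr (ennreal ?a) p + epowr (ennreal ?b) p)"
        using \<open>0 < p\<close> by (rule epowr_add_le)
      finally show ?thesis using ab by (simp add: epowr_ennreal)
    qed
    then show "ennreal (decr_rearr M f (2 * \<sigma>) powr p) * indicator {0<..<t / 2} \<sigma>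
        \<le> ennreal (2 powr p) * (ennreal (?a powr p) + ennreal (?b powr p)) * indicator {0<..<t} \<sigma>"
      by (auto simp: indicator_def)
  qed simp
  also have "(\<integral>\<^sup>+ \<sigma>\<in>{0<..<t}. ennreal (2 powr p) *
        (ennreal (decr_rearr M g \<sigma> powr p) + ennreal (decr_rearr M k \<sigma> powr p)) \<partial>lborel)
      = ennreal (2 powr p) * (?P g t + ?P k t)"
    by (simp add: distrib_right mult.assoc nn_integral_cmult nn_integral_add)
  also have "ennreal 2 * (ennreal (2 powr p) * (?P g t + ?P k t)) = ennreal (2 powr (1 + p)) * (?P g t + ?P k t)"
  proof -
    have "2 powr (1 + p) = 2 * 2 powr p" by (simp add: powr_add)
    then show ?thesis by (simp only: ennreal_mult powr_ge_zero mult.assoc zero_le_numeral)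
  qed
  finally have "head_norm M p f t \<le> epowr (ennreal (2 powr (1 + p)) * (?P g t + ?P k t)) (1 / p)"
    unfolding head_norm_def using \<open>0 < p\<close> by (intro epowr_mono) auto
  also have "\<dots> = ennreal (2 powr (1 / p + 1)) * epowr (?P g t + ?P k t) (1 / p)"
    using \<open>0 < p\<close> by (simp add: epowr_mult epowr_ennreal powr_powr add_divide_distrib)
  also have "\<dots> \<le> ennreal (2 powr (1 / p + 1)) * (ennreal (2 powr (1 / p)) * (head_norm M p g t + head_norm M p k t))"
    unfolding head_norm_def using \<open>0 < p\<close> by (intro mult_left_mono epowr_add_le) auto
  also have "\<dots> = ennreal (2 powr (1 + 2 / p)) * (head_norm M p g t + head_norm M p k t)"
  proof -
    have "2 powr (1 / p + 1) * 2 powr (1 / p) = 2 powr (1 + 2 / p)"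
      by (simp add: powr_add[symmetric] add.commute)
    then show ?thesis by (simp add: mult.assoc[symmetric] flip: ennreal_mult)
  qed
  finally show ?thesis .
qed

lemma Lp_norm_eq_head_norm:
  assumes M: "emeasure M (space M) = 1" and f: "f \<in> borel_measurable M"
  shows "Lp_norm M p f = head_norm M p f 1"
  unfolding Lp_norm_def head_norm_def
  using nn_integral_decr_rearr[OF M f, of "\<lambda>y. ennreal (y powr p)"] by simp

lemma small_Lp_norm_eq_head_norm:
  "small_Lp_norm M p f
     = (\<integral>\<^sup>+ t\<in>{0<..<1}. ennreal ((1 - ln t) powr (- (1 / p)) / t) * head_norm M p f t \<partial>lborel)"
  by (simp add: small_Lp_norm_def head_norm_def)

lemma GGamma_norm_eq_head_norm:
  assumes w1: "\<And>t. 0 < t \<Longrightarrow> t < 1 \<Longrightarrow> w1 t = w t"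
  shows "GGamma_norm M p r w1 (\<lambda>_. 1) f
     = epowr (\<integral>\<^sup>+ t\<in>{0<..<1}. ennreal (w t) * epowr (head_norm M p f t) r \<partial>lborel) (1 / r)"
  unfolding GGamma_norm_def head_norm_def epowr_epowr
  using w1 by (intro arg_cong[where f="\<lambda>x. epowr x (1 / r)"] nn_integral_cong) (auto simp: indicator_def)

text \<open>
  The excess of \<open>\<bar>f\<bar>\<close> over the height \<open>a\<close> has a rearrangement that vanishes beyond \<open>t\<close>.
\<close>

lemma Lp_norm_excess_le:
  assumes M: "emeasure M (space M) = 1" and f: "f \<in> borel_measurable M" and "0 < p" "0 < t"
  defines "a \<equiv> decr_rearr M f t"
  assumes g: "\<And>x. \<bar>g x\<bar> = max 0 (\<bar>f x\<bar> - a)"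
  shows "Lp_norm M p g \<le> head_norm M p f t"
proof -
  have a: "0 \<le> a" unfolding a_def using M f \<open>0 < t\<close> by (rule decr_rearr_ge_0)
  have "(\<integral>\<^sup>+ x. ennreal (\<bar>g x\<bar> powr p) \<partial>M) = (\<integral>\<^sup>+ x. ennreal (max 0 (\<bar>f x\<bar> - a) powr p) \<partial>M)"
    by (simp add: g)
  also have "\<dots> = (\<integral>\<^sup>+ s\<in>{0<..<1}. ennreal (max 0 (decr_rearr M f s - a) powr p) \<partial>lborel)"
    by (rule nn_integral_decr_rearr[OF M f]) measurable
  also have "\<dots> \<le> (\<integral>\<^sup>+ s\<in>{0<..<t}. ennreal (decr_rearr M f s powr p) \<partial>lborel)"
  proof (intro nn_integral_mono)
    fix s :: real
    have "max 0 (decr_rearr M f s - a) = 0" if "t \<le> s"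
      using decr_rearr_antimono[OF M f \<open>0 < t\<close> that] by (simp add: a_def)
    moreover have "max 0 (decr_rearr M f s - a) powr p \<le> decr_rearr M f s powr p" if "0 < s"
      using a decr_rearr_ge_0[OF M f that] \<open>0 < p\<close> by (intro powr_mono2) auto
    ultimately show "ennreal (max 0 (decr_rearr M f s - a) powr p) * indicator {0<..<1} s
        \<le> ennreal (decr_rearr M f s powr p) * indicator {0<..<t} s"
      by (cases "s < t") (auto simp: indicator_def intro!: ennreal_leI)
  qed
  finally show ?thesis
    unfolding Lp_norm_def head_norm_def using \<open>0 < p\<close> by (intro epowr_mono) auto
qed

text \<open>
  Both sides are compared with a constant function of height \<open>decr_rearr M f t\<close>: it dominates the
  rearrangement of \<open>g\<close>, and lies below that of \<open>f\<close> on \<open>{0<..<t}\<close>. The bound decays as \<open>s\<close> tends to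
  \<open>0\<close>, which the head norm of \<open>f\<close> itself need not do at any rate.
\<close>

lemma head_norm_truncated_le:
  assumes M: "emeasure M (space M) = 1" and f: "f \<in> borel_measurable M" and g: "g \<in> borel_measurable M"
    and "0 < p" "0 < s" "0 < t"
    and bound: "\<And>x. \<bar>g x\<bar> \<le> decr_rearr M f t"
  shows "head_norm M p g s \<le> ennreal ((s / t) powr (1 / p)) * head_norm M p f t"
proof -
  define a where "a = decr_rearr M f t"
  have a: "0 \<le> a" unfolding a_def using M f \<open>0 < t\<close> by (rule decr_rearr_ge_0)
  have "(\<integral>\<^sup>+ \<sigma>\<in>{0<..<s}. ennreal (decr_rearr M g \<sigma> powr p) \<partial>lborel)
      \<le> (\<integral>\<^sup>+ \<sigma>. ennreal (a powr p) * indicator {0<..<s} \<sigma> \<partial>lborel)"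
  proof (intro nn_integral_mono)
    fix \<sigma> :: real
    have "decr_rearr M g \<sigma> powr p \<le> a powr p" if "0 < \<sigma>"
      using that \<open>0 < p\<close> a bound M g
      by (intro powr_mono2 decr_rearr_le_bound decr_rearr_ge_0) (auto simp: a_def)
    then show "ennreal (decr_rearr M g \<sigma> powr p) * indicator {0<..<s} \<sigma> \<le> ennreal (a powr p) * indicator {0<..<s} \<sigma>"
      by (auto simp: indicator_def intro!: ennreal_leI)
  qed
  also have "\<dots> = ennreal (s / t) * (\<integral>\<^sup>+ \<sigma>. ennreal (a powr p) * indicator {0<..<t} \<sigma> \<partial>lborel)"
    using \<open>0 < s\<close> \<open>0 < t\<close> by (simp add: nn_integral_cmult_indicator ac_simps flip: ennreal_mult)
  also have "\<dots> \<le> ennreal (s / t) * (\<integral>\<^sup>+ \<sigma>\<in>{0<..<t}. ennreal (decr_rearr M f \<sigma> powr p) \<partial>lborel)"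
  proof (intro mult_left_mono nn_integral_mono)
    fix \<sigma> :: real
    have "a powr p \<le> decr_rearr M f \<sigma> powr p" if "0 < \<sigma>" "\<sigma> < t"
      using that \<open>0 < p\<close> a M f unfolding a_def by (intro powr_mono2 decr_rearr_antimono) auto
    then show "ennreal (a powr p) * indicator {0<..<t} \<sigma> \<le> ennreal (decr_rearr M f \<sigma> powr p) * indicator {0<..<t} \<sigma>"
      by (auto simp: indicator_def intro!: ennreal_leI)
  qed simp
  finally have "head_norm M p g s
      \<le> epowr (ennreal (s / t) * (\<integral>\<^sup>+ \<sigma>\<in>{0<..<t}. ennreal (decr_rearr M f \<sigma> powr p) \<partial>lborel)) (1 / p)"
    unfolding head_norm_def using \<open>0 < p\<close> by (intro epowr_mono) auto
  then show ?thesis using \<open>0 < s\<close> \<open>0 < t\<close> by (simp add: head_norm_def epowr_mult epowr_ennreal)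
qed

lemma head_norm_mono_fun:
  assumes "emeasure M (space M) = 1" "f \<in> borel_measurable M" "g \<in> borel_measurable M" "0 < p"
    and "\<And>x. \<bar>g x\<bar> \<le> \<bar>f x\<bar>"
  shows "head_norm M p g t \<le> head_norm M p f t"
  unfolding head_norm_def
proof (intro epowr_mono nn_integral_mono)
  fix \<sigma> :: real
  have "decr_rearr M g \<sigma> powr p \<le> decr_rearr M f \<sigma> powr p" if "0 < \<sigma>"
    using that assms by (intro powr_mono2 decr_rearr_mono decr_rearr_ge_0) auto
  then show "ennreal (decr_rearr M g \<sigma> powr p) * indicator {0<..<t} \<sigma>
      \<le> ennreal (decr_rearr M f \<sigma> powr p) * indicator {0<..<t} \<sigma>"
    by (auto simp: indicator_def intro!: ennreal_leI)
qed (use assms in auto)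

section \<open>Two-sided bounds for the K-functional\<close>

text \<open>
  On \<open>{0<..t}\<close> the head norm of the truncation decays like \<open>x powr (1 / p)\<close>, so the
  integral over it against \<open>dx / x\<close> is at most a multiple of the integrand at \<open>t\<close>; on \<open>{t<..<1}\<close> the truncation is simply dominated by \<open>f\<close>.
\<close>

lemma small_Lp_norm_truncated_le:
  assumes M: "emeasure M (space M) = 1" and f: "f \<in> borel_measurable M" and g: "g \<in> borel_measurable M"
    and "1 < p" and t: "0 < t" "t < 1" and \<beta>: "\<beta> = 1 - 1 / p"
    and gf: "\<And>x. \<bar>g x\<bar> \<le> \<bar>f x\<bar>" and bound: "\<And>x. \<bar>g x\<bar> \<le> decr_rearr M f t"
  shows "small_Lp_norm M p g \<le> ennreal (p * (1 - ln t) powr (\<beta> - 1)) * head_norm M p f t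
     + (\<integral>\<^sup>+ x\<in>{t<..<1}. ennreal ((1 - ln x) powr (\<beta> - 1) / x) * head_norm M p f x \<partial>lborel)"
proof -
  note [measurable] = borel_measurable_head_norm[OF M f] borel_measurable_head_norm[OF M g]
  define w where "w = (\<lambda>x::real. ennreal ((1 - ln x) powr (\<beta> - 1) / x))"
  have [measurable]: "w \<in> borel_measurable borel" unfolding w_def by measurable
  define a where "a = (1 - ln t) powr (\<beta> - 1) * t powr (- (1 / p))"
  have "small_Lp_norm M p g = (\<integral>\<^sup>+ x\<in>{0<..<1}. w x * head_norm M p g x \<partial>lborel)"
    by (simp add: small_Lp_norm_eq_head_norm w_def \<beta>)
  also have "\<dots> \<le> (\<integral>\<^sup>+ x. (ennreal a * head_norm M p f t) * (ennreal (x powr (1 / p - 1)) * indicator {0..t} x)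
      + w x * head_norm M p f x * indicator {t<..<1} x \<partial>lborel)"
  proof (intro nn_integral_mono)
    fix x :: real
    show "w x * head_norm M p g x * indicator {0<..<1} x
      \<le> (ennreal a * head_norm M p f t) * (ennreal (x powr (1 / p - 1)) * indicator {0..t} x)
        + w x * head_norm M p f x * indicator {t<..<1} x"
    proof (cases "0 < x \<and> x \<le> t")
      case True
      then have x: "0 < x" "x \<le> t" "x < 1" using t by auto
      have "head_norm M p g x \<le> ennreal ((x / t) powr (1 / p)) * head_norm M p f t"
        using M f g \<open>1 < p\<close> x t bound by (intro head_norm_truncated_le) auto
      then have "w x * head_norm M p g x \<le> w x * (ennreal ((x / t) powr (1 / p)) * head_norm M p f t)"
        by (rule mult_left_mono) simp
      also have "\<dots> = ennreal ((1 - ln x) powr (\<beta> - 1) / x * (x / t) powr (1 / p)) * head_norm M p f t"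
        unfolding w_def using x by (subst ennreal_mult) (auto simp: mult.assoc)
      also have "\<dots> \<le> ennreal (a * x powr (1 / p - 1)) * head_norm M p f t"
      proof (intro mult_right_mono ennreal_leI)
        have "ln t < 0" "ln x \<le> ln t" using x t by simp_all
        then have "0 < 1 - ln t" "1 - ln t \<le> 1 - ln x" by linarith+
        then have "(1 - ln x) powr (\<beta> - 1) \<le> (1 - ln t) powr (\<beta> - 1)"
          using \<open>1 < p\<close> by (intro powr_mono2') (simp_all add: \<beta>)
        moreover have "(x / t) powr (1 / p) / x = t powr (- (1 / p)) * x powr (1 / p - 1)"
          using x t by (simp add: powr_divide powr_diff powr_minus field_simps)
        ultimately have "(1 - ln x) powr (\<beta> - 1) * ((x / t) powr (1 / p) / x)
            \<le> (1 - ln t) powr (\<beta> - 1) * (t powr (- (1 / p)) * x powr (1 / p - 1))"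
          by (simp add: mult_right_mono)
        then show "(1 - ln x) powr (\<beta> - 1) / x * (x / t) powr (1 / p) \<le> a * x powr (1 / p - 1)"
          by (simp add: a_def)
      qed simp
      also have "\<dots> = (ennreal a * head_norm M p f t) * ennreal (x powr (1 / p - 1))"
        by (simp add: a_def ennreal_mult ac_simps)
      finally show ?thesis using x t by simp
    next
      case False
      have "head_norm M p g x \<le> head_norm M p f x"
        using M f g \<open>1 < p\<close> gf by (intro head_norm_mono_fun) auto
      with False show ?thesis by (auto simp: indicator_def mult_left_mono)
    qed
  qed
  also have "\<dots> = (ennreal a * head_norm M p f t) * (\<integral>\<^sup>+ x. ennreal (x powr (1 / p - 1)) * indicator {0..t} x \<partial>lborel)
      + (\<integral>\<^sup>+ x\<in>{t<..<1}. w x * head_norm M p f x \<partial>lborel)"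
    by (subst nn_integral_add) (auto simp: nn_integral_cmult)
  also have "(\<integral>\<^sup>+ x. ennreal (x powr (1 / p - 1)) * indicator {0..t} x \<partial>lborel) = ennreal (p * t powr (1 / p))"
    using has_integral_powr_from_0[of "1 / p - 1" t] \<open>1 < p\<close> t
    by (subst nn_integral_has_integral_lebesgue') (auto simp: mult.commute)
  also have "(ennreal a * head_norm M p f t) * ennreal (p * t powr (1 / p))
      = ennreal (p * (1 - ln t) powr (\<beta> - 1)) * head_norm M p f t"
  proof -
    have "a * (p * t powr (1 / p)) = p * (1 - ln t) powr (\<beta> - 1)"
      using t by (simp add: a_def powr_minus)
    moreover have "0 \<le> a" by (simp add: a_def)
    ultimately have "ennreal a * ennreal (p * t powr (1 / p)) = ennreal (p * (1 - ln t) powr (\<beta> - 1))"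
      using \<open>1 < p\<close> by (simp flip: ennreal_mult)
    then show ?thesis by (metis mult.assoc mult.commute)
  qed
  finally show ?thesis by (simp add: w_def)
qed

lemma head_norm_one_finite:
  assumes "emeasure M (space M) = 1" "f \<in> borel_measurable M" "0 < p" "0 < t" "t \<le> 1" "head_norm M p f t \<noteq> top"
  shows "head_norm M p f 1 < top"
proof -
  have "head_norm M p f 1 \<le> ennreal ((1 / t) powr (1 / p)) * head_norm M p f t"
    using head_norm_dilate_le[OF assms(1-3), of "1 / t" t] assms by simp
  also have "\<dots> < top" using assms by (simp add: ennreal_mult_less_top less_top)
  finally show ?thesis .
qed

text \<open>
  The decomposition cuts \<open>f\<close> at the height \<open>a = decr_rearr M f t\<close>: the excess over \<open>a\<close> goes to \<open>L\<^sup>p\<close>, the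
  truncated function to the small Lebesgue space. If the head norm is infinite, so is the bound.
\<close>

lemma K_functional_le:
  assumes M: "emeasure M (space M) = 1" and f: "f \<in> borel_measurable M"
    and p: "1 < p" and t: "0 < t" "t < 1" and \<beta>: "\<beta> = 1 - 1 / p"
  shows "K_functional M (Lp_norm M p) (small_Lp_norm M p) f ((1 - ln t) powr (- \<beta>))
     \<le> ennreal (1 + p) * head_norm M p f t + ennreal ((1 - ln t) powr (- \<beta>)) *
         (\<integral>\<^sup>+ x\<in>{t<..<1}. ennreal ((1 - ln x) powr (\<beta> - 1) / x) * head_norm M p f x \<partial>lborel)"
proof (cases "head_norm M p f t = top")
  case True
  then show ?thesis using p by (simp add: ennreal_mult_top)
next
  case False
  have [measurable]: "f \<in> borel_measurable M" by fact
  have H1: "head_norm M p f 1 < top"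
    using head_norm_one_finite[OF M f _ _ _ False] p t by simp
  define A where "A = (\<integral>\<^sup>+ x\<in>{t<..<1}. ennreal ((1 - ln x) powr (\<beta> - 1) / x) * head_norm M p f x \<partial>lborel)"
  define l where "l = 1 - ln t"
  have l: "1 < l" using t by (simp add: l_def)
  have "A \<le> (\<integral>\<^sup>+ x. head_norm M p f 1 * (ennreal ((1 - ln x) powr (\<beta> - 1) / x) * indicator {t<..<1} x) \<partial>lborel)"
    unfolding A_def using head_norm_mono[of _ 1 p M f] p
    by (intro nn_integral_mono) (auto simp: indicator_def mult.commute intro!: mult_right_mono)
  also have "\<dots> = head_norm M p f 1 * (\<integral>\<^sup>+ x\<in>{t<..<1}. ennreal ((1 - ln x) powr (\<beta> - 1) / x) \<partial>lborel)"
    by (intro nn_integral_cmult) measurable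
  also have "\<dots> \<le> head_norm M p f 1 * ennreal (l powr \<beta> / \<beta>)"
    unfolding l_def using p t by (intro mult_left_mono nn_integral_log_powr_above) (auto simp: \<beta>)
  also have "\<dots> < top" using H1 by (simp add: ennreal_mult_less_top)
  finally have A: "A < top" .
  define a where "a = decr_rearr M f t"
  have a: "0 \<le> a" unfolding a_def using M f t(1) by (rule decr_rearr_ge_0)
  \<comment> \<open>Truncation of \<open>f\<close> to the range from \<open>- a\<close> to \<open>a\<close>; the excess \<open>f0\<close> vanishes where \<open>\<bar>f\<bar> \<le> a\<close>.\<close>
  define f1 where "f1 = (\<lambda>x. max (- a) (min a (f x)))"
  define f0 where "f0 = (\<lambda>x. f x - f1 x)"
  have [measurable]: "f1 \<in> borel_measurable M" "f0 \<in> borel_measurable M"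
    unfolding f0_def f1_def by measurable
  have f0: "Lp_norm M p f0 \<le> head_norm M p f t"
    using M f p t a by (intro Lp_norm_excess_le) (auto simp: f0_def f1_def a_def[symmetric])
  have f1: "small_Lp_norm M p f1 \<le> ennreal (p * l powr (\<beta> - 1)) * head_norm M p f t + A"
    unfolding A_def l_def
    using M f p t a \<beta> by (intro small_Lp_norm_truncated_le) (auto simp: f1_def a_def[symmetric])
  have "small_Lp_norm M p f1 < top"
    using f1 A False by (elim le_less_trans) (simp add: ennreal_mult_less_top less_top)
  moreover have "Lp_norm M p f0 < top"
    using f0 False by (elim le_less_trans) (simp add: less_top)
  ultimately have "(f0, f1) \<in> decompositions M (Lp_norm M p) (small_Lp_norm M p) f"
    by (auto simp: decompositions_def fun_space_def f0_def)
  then have "K_functional M (Lp_norm M p) (small_Lp_norm M p) f (l powr (- \<beta>))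
      \<le> Lp_norm M p f0 + ennreal (l powr (- \<beta>)) * small_Lp_norm M p f1"
    unfolding K_functional_def by (rule INF_lower2) simp
  also have "\<dots> \<le> head_norm M p f t
      + ennreal (l powr (- \<beta>)) * (ennreal (p * l powr (\<beta> - 1)) * head_norm M p f t + A)"
    by (intro add_mono mult_left_mono f0 f1) simp
  also have "\<dots> = head_norm M p f t + ennreal (l powr (- \<beta>) * (p * l powr (\<beta> - 1))) * head_norm M p f t
      + ennreal (l powr (- \<beta>)) * A"
    using p by (simp add: ennreal_mult distrib_left mult.assoc add.assoc)
  also have "\<dots> \<le> head_norm M p f t + ennreal p * head_norm M p f t + ennreal (l powr (- \<beta>)) * A"
  proof (intro add_mono mult_right_mono ennreal_leI order_refl)
    \<comment> \<open>The factor in front of the second head norm is \<open>p / l\<close>, hence bounded.\<close>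
    have "l powr (- \<beta>) * l powr (\<beta> - 1) = l powr (- 1)" by (simp add: powr_add[symmetric])
    also have "\<dots> \<le> 1" using l by (simp add: powr_minus_divide)
    finally show "l powr (- \<beta>) * (p * l powr (\<beta> - 1)) \<le> p"
      using p mult_left_mono[of "l powr (- \<beta>) * l powr (\<beta> - 1)" 1 p] by (simp add: ac_simps)
  qed simp_all
  also have "head_norm M p f t + ennreal p * head_norm M p f t = ennreal (1 + p) * head_norm M p f t"
    using p by (simp add: distrib_right ennreal_plus)
  finally show ?thesis by (simp add: A_def l_def)
qed

text \<open>
  On \<open>{t / e<..<1}\<close> the head norm is at least its value at \<open>t / e\<close>, which is comparable to its value
  at \<open>t\<close>, and the logarithmic weight is at least of the order of \<open>(1 - ln t) powr (\<beta> - 1) / x\<close>. Starting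
  the integral at \<open>t / e\<close> instead of \<open>t\<close> makes the length \<open>1 - ln t\<close> of the interval in the measure
  \<open>dx / x\<close> stay away from \<open>0\<close> as \<open>t\<close> tends to \<open>1\<close>.
\<close>

lemma head_norm_le_small_Lp_norm:
  assumes M: "emeasure M (space M) = 1" and f: "f \<in> borel_measurable M"
    and p: "1 < p" and t: "0 < t" "t < 1" and \<beta>: "\<beta> = 1 - 1 / p"
  shows "head_norm M p f t
     \<le> ennreal (2 * exp (1 / p)) * (ennreal ((1 - ln t) powr (- \<beta>)) * small_Lp_norm M p f)"
proof -
  \<comment> \<open>The dilation factor \<open>e\<close> is convenient because \<open>- ln u = 1 - ln t\<close>.\<close>
  define u where "u = t / exp 1"
  define l where "l = 1 - ln t"
  have l: "1 < l" using t by (simp add: l_def)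
  have u: "0 < u" "u < 1" "ln u = - l"
    using t by (auto simp: u_def l_def ln_div intro: less_trans[of _ "1::real"])
  have "head_norm M p f t \<le> ennreal (exp 1 powr (1 / p)) * head_norm M p f u"
    using head_norm_dilate_le[OF M f, of p "exp 1" u] p by (simp add: u_def)
  also have "exp 1 powr (1 / p) = exp (1 / p)" by (simp add: powr_def)
  finally have step1: "head_norm M p f t \<le> ennreal (exp (1 / p)) * head_norm M p f u" .
  have "ennreal l = (\<integral>\<^sup>+ x. ennreal (1 / x) * indicator {u..1} x \<partial>lborel)"
  proof (subst nn_integral_FTC_Icc[where F=ln])
    show "(ln has_real_derivative 1 / x) (at x)" if "x \<in> {u..1}" for x
      using that u by (auto intro!: derivative_eq_intros)
  qed (use u in auto)
  also have "\<dots> = (\<integral>\<^sup>+ x\<in>{u<..<1}. ennreal (1 / x) \<partial>lborel)"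
    by (intro nn_integral_cong_AE eventually_mono[OF AE_conjI[OF AE_lborel_singleton[of u] AE_lborel_singleton[of 1]]])
       (auto simp: indicator_def)
  finally have log: "ennreal l = (\<integral>\<^sup>+ x\<in>{u<..<1}. ennreal (1 / x) \<partial>lborel)" .
  define C where "C = ennreal ((2 * l) powr (\<beta> - 1)) * head_norm M p f u"
  have "C * ennreal l = (\<integral>\<^sup>+ x. C * (ennreal (1 / x) * indicator {u<..<1} x) \<partial>lborel)"
    unfolding log by (intro nn_integral_cmult[symmetric]) measurable
  also have "\<dots> \<le> small_Lp_norm M p f"
    unfolding small_Lp_norm_eq_head_norm
  proof (intro nn_integral_mono)
    fix x :: real
    have "C * ennreal (1 / x) \<le> ennreal ((1 - ln x) powr (- (1 / p)) / x) * head_norm M p f x"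
      if x: "u < x" "x < 1"
    proof -
      have "0 < x" using u x by simp
      moreover have "- l < ln x" using u x by (metis ln_less_cancel_iff \<open>0 < x\<close>)
      moreover have "ln x < 0" using x \<open>0 < x\<close> by simp
      ultimately have "0 < 1 - ln x" "1 - ln x \<le> 2 * l" using l by linarith+
      then have "(2 * l) powr (- (1 / p)) \<le> (1 - ln x) powr (- (1 / p))"
        using p by (intro powr_mono2') auto
      then have "(2 * l) powr (\<beta> - 1) \<le> (1 - ln x) powr (- (1 / p))"
        by (simp add: \<beta>)
      then have "(2 * l) powr (\<beta> - 1) * (1 / x) \<le> (1 - ln x) powr (- (1 / p)) / x"
        using \<open>0 < x\<close> by (simp add: divide_right_mono)
      then have "ennreal ((2 * l) powr (\<beta> - 1)) * ennreal (1 / x) \<le> ennreal ((1 - ln x) powr (- (1 / p)) / x)"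
        by (subst ennreal_mult[symmetric]) (use \<open>0 < x\<close> in \<open>auto intro!: ennreal_leI\<close>)
      moreover have "head_norm M p f u \<le> head_norm M p f x" using x p by (intro head_norm_mono) auto
      ultimately have "(ennreal ((2 * l) powr (\<beta> - 1)) * ennreal (1 / x)) * head_norm M p f u
          \<le> ennreal ((1 - ln x) powr (- (1 / p)) / x) * head_norm M p f x"
        by (intro mult_mono) auto
      then show ?thesis by (simp add: C_def ac_simps)
    qed
    then show "C * (ennreal (1 / x) * indicator {u<..<1} x)
        \<le> ennreal ((1 - ln x) powr (- (1 / p)) / x) * head_norm M p f x * indicator {0<..<1} x"
      using u by (auto simp: indicator_def)
  qed
  finally have step2: "C * ennreal l \<le> small_Lp_norm M p f" .
  have "head_norm M p f u = ennreal ((2 * l) powr (1 - \<beta>) * l powr (- 1)) * (C * ennreal l)"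
  proof -
    have "(2 * l) powr (1 - \<beta>) * l powr (- 1) * ((2 * l) powr (\<beta> - 1) * l) = 1"
    proof -
      have "(2 * l) powr (1 - \<beta>) * (2 * l) powr (\<beta> - 1) = 1" "l powr (- 1) * l = 1"
        using l by (simp_all add: powr_add[symmetric] powr_minus_divide)
      then show ?thesis by (metis mult.assoc mult.commute mult_1)
    qed
    moreover have "ennreal ((2 * l) powr (1 - \<beta>) * l powr (- 1)) * (C * ennreal l)
        = ennreal ((2 * l) powr (1 - \<beta>) * l powr (- 1) * ((2 * l) powr (\<beta> - 1) * l)) * head_norm M p f u"
      using l unfolding C_def by (subst (2) ennreal_mult, simp, simp, subst (3) ennreal_mult) (auto simp: ac_simps)
    ultimately show ?thesis by simp
  qed
  also have "\<dots> \<le> ennreal (2 * l powr (- \<beta>)) * small_Lp_norm M p f"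
  proof (rule mult_mono[OF ennreal_leI step2])
    have "(2 * l) powr (1 - \<beta>) * l powr (- 1) = 2 powr (1 - \<beta>) * l powr (- \<beta>)"
      using l by (simp add: powr_mult powr_diff powr_minus field_simps)
    also have "\<dots> \<le> 2 powr 1 * l powr (- \<beta>)"
      using p by (intro mult_right_mono powr_mono) (auto simp: \<beta>)
    finally show "(2 * l) powr (1 - \<beta>) * l powr (- 1) \<le> 2 * l powr (- \<beta>)" by simp
  qed auto
  finally have "ennreal (exp (1 / p)) * head_norm M p f u
      \<le> ennreal (exp (1 / p)) * (ennreal (2 * l powr (- \<beta>)) * small_Lp_norm M p f)"
    by (rule mult_left_mono) simp
  also have "\<dots> = ennreal (2 * exp (1 / p)) * (ennreal (l powr (- \<beta>)) * small_Lp_norm M p f)"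
    by (simp add: ennreal_mult ac_simps)
  finally show ?thesis using step1 unfolding l_def by (rule order_trans[rotated])
qed

text \<open>
  For any decomposition \<open>f = g + k\<close>, the head norm of \<open>g\<close> is at most its full norm in \<open>L\<^sup>p\<close>, and that of
  \<open>k\<close> is controlled by its norm in the small Lebesgue space.
\<close>

lemma head_norm_le_K_functional:
  assumes M: "emeasure M (space M) = 1"
    and p: "1 < p" and \<beta>: "\<beta> = 1 - 1 / p"
  obtains C where "0 < C"
    "\<And>f t. f \<in> borel_measurable M \<Longrightarrow> 0 < t \<Longrightarrow> t < 1 \<Longrightarrow>
      head_norm M p f t \<le> ennreal C * K_functional M (Lp_norm M p) (small_Lp_norm M p) f ((1 - ln t) powr (- \<beta>))"
proof -
  define a where "a = 2 powr (1 + 2 / p)"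
  define C where "C = a * (2 * exp (1 / p))"
  have "0 < C" by (simp add: C_def a_def)
  have "1 \<le> exp (1 / p)" using p by simp
  then have "1 \<le> 2 * exp (1 / p)" by linarith
  have "head_norm M p f t \<le> ennreal C * K_functional M (Lp_norm M p) (small_Lp_norm M p) f ((1 - ln t) powr (- \<beta>))"
    if f: "f \<in> borel_measurable M" and t: "0 < t" "t < 1" for f t
  proof -
    have "ennreal (1 / C) * head_norm M p f t \<le> Lp_norm M p g + ennreal ((1 - ln t) powr (- \<beta>)) * small_Lp_norm M p k"
      if gk: "(g, k) \<in> decompositions M (Lp_norm M p) (small_Lp_norm M p) f" for g k
    proof -
      have g: "g \<in> borel_measurable M" and k: "k \<in> borel_measurable M" and s: "AE x in M. f x = g x + k x"
        using gk by (auto simp: decompositions_def fun_space_def)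
      have "head_norm M p f t \<le> ennreal a * (head_norm M p g t + head_norm M p k t)"
        unfolding a_def using p by (intro head_norm_add_le[OF M f g k s]) simp
      also have "head_norm M p g t \<le> Lp_norm M p g"
        unfolding Lp_norm_eq_head_norm[OF M g] using p t by (intro head_norm_mono) auto
      also have "Lp_norm M p g \<le> ennreal (2 * exp (1 / p)) * Lp_norm M p g"
        using mult_right_mono[OF ennreal_leI[OF \<open>1 \<le> 2 * exp (1 / p)\<close>], of "Lp_norm M p g"] by simp
      also have "head_norm M p k t
          \<le> ennreal (2 * exp (1 / p)) * (ennreal ((1 - ln t) powr (- \<beta>)) * small_Lp_norm M p k)"
        using M k p t \<beta> by (rule head_norm_le_small_Lp_norm)
      finally have "head_norm M p f t \<le> ennreal a * (ennreal (2 * exp (1 / p)) * Lp_norm M p g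
          + ennreal (2 * exp (1 / p)) * (ennreal ((1 - ln t) powr (- \<beta>)) * small_Lp_norm M p k))"
        by (simp add: add_mono mult_left_mono)
      also have "\<dots> = ennreal C * (Lp_norm M p g + ennreal ((1 - ln t) powr (- \<beta>)) * small_Lp_norm M p k)"
        by (simp add: C_def a_def ennreal_mult distrib_left mult.assoc)
      finally have "ennreal (1 / C) * head_norm M p f t
          \<le> ennreal (1 / C) * (ennreal C * (Lp_norm M p g + ennreal ((1 - ln t) powr (- \<beta>)) * small_Lp_norm M p k))"
        by (rule mult_left_mono) simp
      then show ?thesis using \<open>0 < C\<close> by (simp add: mult.assoc[symmetric] flip: ennreal_mult)
    qed
    then have "ennreal (1 / C) * head_norm M p f t
        \<le> K_functional M (Lp_norm M p) (small_Lp_norm M p) f ((1 - ln t) powr (- \<beta>))"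
      unfolding K_functional_def by (intro INF_greatest) auto
    then have "ennreal C * (ennreal (1 / C) * head_norm M p f t)
        \<le> ennreal C * K_functional M (Lp_norm M p) (small_Lp_norm M p) f ((1 - ln t) powr (- \<beta>))"
      by (rule mult_left_mono) simp
    then show ?thesis using \<open>0 < C\<close> by (simp add: mult.assoc[symmetric] flip: ennreal_mult)
  qed
  with \<open>0 < C\<close> show thesis by (rule that)
qed

section \<open>Comparison of the interpolation norm with the Gamma norm\<close>

text \<open>
  Here \<open>exp (1 - s powr (- (1 / \<beta>)))\<close> is the inverse of the substitution
  \<open>s = (1 - ln t) powr (- \<beta>)\<close>. The identity serves for measurable bounds \<open>\<Psi>\<close> of the K-functional,
  from below and from above, and the integral of the K-functional is compared with theirs by
  monotonicity.
\<close>

lemma nn_integral_interp_subst: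
  fixes \<Psi> :: "real \<Rightarrow> ennreal"
  assumes [measurable]: "\<Psi> \<in> borel_measurable borel" and "0 < \<beta>"
  shows "(\<integral>\<^sup>+ s\<in>{0<..<1}. epowr (ennreal (s powr (- \<theta>)) * \<Psi> (exp (1 - s powr (- (1 / \<beta>))))) r * ennreal (1 / s) \<partial>lborel)
    = ennreal \<beta> * (\<integral>\<^sup>+ t\<in>{0<..<1}. ennreal ((1 - ln t) powr (r * (\<theta> * \<beta>) - 1) / t) * epowr (\<Psi> t) r \<partial>lborel)"
proof -
  note [measurable] = measurable_compose[OF _ measurable_epowr]
  have "(\<integral>\<^sup>+ s\<in>{0<..<1}. epowr (ennreal (s powr (- \<theta>)) * \<Psi> (exp (1 - s powr (- (1 / \<beta>))))) r * ennreal (1 / s) \<partial>lborel)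
      = (\<integral>\<^sup>+ t. ennreal \<beta> * (ennreal ((1 - ln t) powr (r * (\<theta> * \<beta>) - 1) / t) * epowr (\<Psi> t) r * indicator {0<..<1} t) \<partial>lborel)"
  proof (subst nn_integral_subst_log_powr[OF _ \<open>0 < \<beta>\<close>], measurable, intro nn_integral_cong)
    fix t :: real
    define l where "l = 1 - ln t"
    show "epowr (ennreal (((1 - ln t) powr (- \<beta>)) powr (- \<theta>)) * \<Psi> (exp (1 - ((1 - ln t) powr (- \<beta>)) powr (- (1 / \<beta>))))) r
          * ennreal (1 / (1 - ln t) powr (- \<beta>)) * ennreal (\<beta> * (1 - ln t) powr (- \<beta> - 1) / t) * indicator {0<..<1} t
        = ennreal \<beta> * (ennreal ((1 - ln t) powr (r * (\<theta> * \<beta>) - 1) / t) * epowr (\<Psi> t) r * indicator {0<..<1} t)"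
    proof (cases "t \<in> {0<..<1}")
      case True
      then have t: "0 < t" "t < 1" by auto
      then have l: "1 < l" by (simp add: l_def)
      have 1: "exp (1 - (l powr (- \<beta>)) powr (- (1 / \<beta>))) = t"
        using \<open>0 < \<beta>\<close> l t by (simp add: powr_powr) (simp add: l_def)
      have "epowr (ennreal ((l powr (- \<beta>)) powr (- \<theta>)) * \<Psi> t) r * ennreal (1 / l powr (- \<beta>)) * ennreal (\<beta> * l powr (- \<beta> - 1) / t)
          = (ennreal (l powr (r * (\<theta> * \<beta>))) * ennreal (1 / l powr (- \<beta>)) * ennreal (\<beta> * l powr (- \<beta> - 1) / t)) * epowr (\<Psi> t) r"
        by (simp add: epowr_mult epowr_ennreal powr_powr ac_simps)
      also have "ennreal (l powr (r * (\<theta> * \<beta>))) * ennreal (1 / l powr (- \<beta>)) * ennreal (\<beta> * l powr (- \<beta> - 1) / t)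
          = ennreal (l powr (r * (\<theta> * \<beta>)) * (1 / l powr (- \<beta>)) * (\<beta> * l powr (- \<beta> - 1) / t))"
        using \<open>0 < \<beta>\<close> t by (simp flip: ennreal_mult)
      also have "l powr (r * (\<theta> * \<beta>)) * (1 / l powr (- \<beta>)) * (\<beta> * l powr (- \<beta> - 1) / t)
          = \<beta> * (l powr (r * (\<theta> * \<beta>) - 1) / t)"
        using l by (simp add: powr_diff)
      finally show ?thesis
        using t \<open>0 < \<beta>\<close> unfolding l_def[symmetric] 1
        by (subst (asm) ennreal_mult) (auto simp: mult.assoc)
    qed simp
  qed
  also have "\<dots> = ennreal \<beta> * (\<integral>\<^sup>+ t\<in>{0<..<1}. ennreal ((1 - ln t) powr (r * (\<theta> * \<beta>) - 1) / t) * epowr (\<Psi> t) r \<partial>lborel)"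
    by (intro nn_integral_cmult) measurable
  finally show ?thesis .
qed

lemma exp_one_minus_powr:
  fixes s :: real
  assumes "0 < s" "s < 1" "0 < \<beta>"
  defines "t \<equiv> exp (1 - s powr (- (1 / \<beta>)))"
  shows "0 < t" "t < 1" "(1 - ln t) powr (- \<beta>) = s"
proof -
  have "1 powr (- (1 / \<beta>)) < s powr (- (1 / \<beta>))"
    using assms by (intro powr_less_mono2_neg) auto
  then show "t < 1" by (simp add: t_def)
  show "(1 - ln t) powr (- \<beta>) = s"
    using assms(1-3) by (simp add: t_def powr_powr)
qed (simp add: t_def)

lemma epowr_root_le:
  assumes "x \<le> ennreal D * y" "0 < D" "1 \<le> r"
  shows "epowr x (1 / r) \<le> ennreal (D powr (1 / r)) * epowr y (1 / r)"
proof -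
  have "epowr x (1 / r) \<le> epowr (ennreal D * y) (1 / r)" using assms by (intro epowr_mono) auto
  then show ?thesis using assms by (simp add: epowr_mult epowr_ennreal)
qed

text \<open>
  The lower bound integrates the pointwise lower bound of the K-functional. For the upper bound, the
  remainder \<open>A\<close> in the pointwise bound is absorbed by Hardy's inequality with \<open>\<eta> = \<theta> * \<beta> < \<beta>\<close>.
  This is where \<open>\<theta> < 1\<close> enters.
\<close>

lemma interp_norm_equivalent:
  fixes M :: "'a measure" and p \<theta> r \<beta> :: real
  assumes M: "emeasure M (space M) = 1" and p: "1 < p" and \<beta>: "\<beta> = 1 - 1 / p"
    and \<theta>: "\<theta> < 1" and r: "1 \<le> r"
  defines "G \<equiv> \<lambda>f. epowr (\<integral>\<^sup>+ t\<in>{0<..<1}. ennreal ((1 - ln t) powr (r * (\<theta> * \<beta>) - 1) / t)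
                * epowr (head_norm M p f t) r \<partial>lborel) (1 / r)"
    and "I \<equiv> interp_norm M (Lp_norm M p) (small_Lp_norm M p) \<theta> r"
  obtains C D where "0 < C" "0 < D"
    "\<And>f. f \<in> borel_measurable M \<Longrightarrow> G f \<le> ennreal C * I f"
    "\<And>f. f \<in> borel_measurable M \<Longrightarrow> I f \<le> ennreal D * G f"
proof -
  have \<beta>0: "0 < \<beta>" using p by (simp add: \<beta>)
  define K where "K = K_functional M (Lp_norm M p) (small_Lp_norm M p)"
  define J where "J = (\<lambda>f. \<integral>\<^sup>+ t\<in>{0<..<1}. ennreal ((1 - ln t) powr (r * (\<theta> * \<beta>) - 1) / t)
                * epowr (head_norm M p f t) r \<partial>lborel)"
  define L where "L = (\<lambda>f. \<integral>\<^sup>+ s\<in>{0<..<1}. epowr (ennreal (s powr (- \<theta>)) * K f s) r * ennreal (1 / s) \<partial>lborel)"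
  define \<tau> where "\<tau> = (\<lambda>s::real. exp (1 - s powr (- (1 / \<beta>))))"
  have \<tau>: "0 < \<tau> s" "\<tau> s < 1" "(1 - ln (\<tau> s)) powr (- \<beta>) = s" if "0 < s" "s < 1" for s
    using exp_one_minus_powr[OF that \<beta>0] by (simp_all only: \<tau>_def)
  obtain c where c: "0 < c" and Kge:
    "\<And>f t. f \<in> borel_measurable M \<Longrightarrow> 0 < t \<Longrightarrow> t < 1 \<Longrightarrow> head_norm M p f t \<le> ennreal c * K f ((1 - ln t) powr (- \<beta>))"
    unfolding K_def using head_norm_le_K_functional[OF M p \<beta>] by metis
  have low: "J f \<le> ennreal (c powr r / \<beta>) * L f" if f: "f \<in> borel_measurable M" for f
  proof -
    note [measurable] = borel_measurable_head_norm[OF M f]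
    \<comment> \<open>Scaled so as to lie below the K-functional.\<close>
    define \<Psi> where "\<Psi> = (\<lambda>t. ennreal (1 / c) * head_norm M p f t)"
    have [measurable]: "\<Psi> \<in> borel_measurable borel" unfolding \<Psi>_def by measurable
    have "ennreal \<beta> * (\<integral>\<^sup>+ t\<in>{0<..<1}. ennreal ((1 - ln t) powr (r * (\<theta> * \<beta>) - 1) / t) * epowr (\<Psi> t) r \<partial>lborel)
       = (\<integral>\<^sup>+ s\<in>{0<..<1}. epowr (ennreal (s powr (- \<theta>)) * \<Psi> (\<tau> s)) r * ennreal (1 / s) \<partial>lborel)"
      unfolding \<tau>_def using \<beta>0 by (intro nn_integral_interp_subst[symmetric]) auto
    also have "\<dots> \<le> L f"
      unfolding L_def
    proof (intro nn_integral_mono)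
      fix s :: real
      have "\<Psi> (\<tau> s) \<le> K f s" if s: "0 < s" "s < 1"
      proof -
        have "\<Psi> (\<tau> s) \<le> ennreal (1 / c) * (ennreal c * K f s)"
          using Kge[OF f \<tau>(1,2)[OF s]] unfolding \<tau>(3)[OF s] \<Psi>_def by (rule mult_left_mono) simp
        then show ?thesis using c by (simp add: mult.assoc[symmetric] flip: ennreal_mult)
      qed
      then show "epowr (ennreal (s powr (- \<theta>)) * \<Psi> (\<tau> s)) r * ennreal (1 / s) * indicator {0<..<1} s
          \<le> epowr (ennreal (s powr (- \<theta>)) * K f s) r * ennreal (1 / s) * indicator {0<..<1} s"
        using r by (auto simp: indicator_def intro!: mult_right_mono epowr_mono mult_left_mono)
    qed
    finally have *: "ennreal \<beta> * (\<integral>\<^sup>+ t\<in>{0<..<1}. ennreal ((1 - ln t) powr (r * (\<theta> * \<beta>) - 1) / t) * epowr (\<Psi> t) r \<partial>lborel) \<le> L f" .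
    note [measurable] = measurable_compose[OF _ measurable_epowr]
    have "(\<integral>\<^sup>+ t\<in>{0<..<1}. ennreal ((1 - ln t) powr (r * (\<theta> * \<beta>) - 1) / t) * epowr (\<Psi> t) r \<partial>lborel)
        = (\<integral>\<^sup>+ t. ennreal (c powr (- r)) * (ennreal ((1 - ln t) powr (r * (\<theta> * \<beta>) - 1) / t) * epowr (head_norm M p f t) r * indicator {0<..<1} t) \<partial>lborel)"
      using c by (intro nn_integral_cong) (simp add: \<Psi>_def epowr_mult epowr_ennreal powr_divide powr_minus_divide ac_simps)
    also have "\<dots> = ennreal (c powr (- r)) * J f"
      unfolding J_def by (intro nn_integral_cmult) measurable
    finally have "ennreal (\<beta> * c powr (- r)) * J f \<le> L f"
      using * \<beta>0 by (simp add: ennreal_mult mult.assoc)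
    then have "ennreal (c powr r / \<beta>) * (ennreal (\<beta> * c powr (- r)) * J f) \<le> ennreal (c powr r / \<beta>) * L f"
      by (rule mult_left_mono) simp
    moreover have "c powr r / \<beta> * (\<beta> * c powr (- r)) = 1"
      using \<beta>0 c by (simp add: powr_minus)
    then have "ennreal (c powr r / \<beta>) * (ennreal (\<beta> * c powr (- r)) * J f) = J f"
      using \<beta>0 by (simp add: mult.assoc[symmetric] flip: ennreal_mult)
    ultimately show ?thesis by simp
  qed
  define D where "D = \<beta> * 2 powr r * ((1 + p) powr r + (\<beta> - \<theta> * \<beta>) powr (- r))"
  have D: "0 < D" using \<beta>0 p by (auto simp: D_def intro!: mult_pos_pos add_pos_nonneg)
  have up: "L f \<le> ennreal D * J f" if f: "f \<in> borel_measurable M" for f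
  proof -
    note [measurable] = borel_measurable_head_norm[OF M f] measurable_compose[OF _ measurable_epowr]
    define A where "A = (\<lambda>t. \<integral>\<^sup>+ x\<in>{t<..<1}. ennreal ((1 - ln x) powr (\<beta> - 1) / x) * head_norm M p f x \<partial>lborel)"
    have [measurable]: "A \<in> borel_measurable borel"
    proof -
      have "(\<lambda>t. \<integral>\<^sup>+ x. ennreal ((1 - ln x) powr (\<beta> - 1) / x) * head_norm M p f x * (if t < x \<and> x < 1 then 1 else 0) \<partial>lborel)
          \<in> borel_measurable borel"
        by measurable
      moreover have "(if t < x \<and> x < 1 then 1 else 0) = (indicator {t<..<1} x :: ennreal)" for x t :: real
        by (auto simp: indicator_def)
      ultimately show ?thesis unfolding A_def by simp
    qed
    \<comment> \<open>The upper bound for the K-functional.\<close>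
    define \<Psi> where "\<Psi> = (\<lambda>t. ennreal (1 + p) * head_norm M p f t + ennreal ((1 - ln t) powr (- \<beta>)) * A t)"
    have [measurable]: "\<Psi> \<in> borel_measurable borel" unfolding \<Psi>_def by measurable
    let ?w = "\<lambda>t. ennreal ((1 - ln t) powr (r * (\<theta> * \<beta>) - 1) / t)"
    have "L f \<le> (\<integral>\<^sup>+ s\<in>{0<..<1}. epowr (ennreal (s powr (- \<theta>)) * \<Psi> (\<tau> s)) r * ennreal (1 / s) \<partial>lborel)"
      unfolding L_def
    proof (intro nn_integral_mono)
      fix s :: real
      have "K f s \<le> \<Psi> (\<tau> s)" if s: "0 < s" "s < 1"
        using K_functional_le[OF M f p \<tau>(1,2)[OF s] \<beta>] unfolding K_def \<Psi>_def A_def \<tau>(3)[OF s] .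
      then show "epowr (ennreal (s powr (- \<theta>)) * K f s) r * ennreal (1 / s) * indicator {0<..<1} s
          \<le> epowr (ennreal (s powr (- \<theta>)) * \<Psi> (\<tau> s)) r * ennreal (1 / s) * indicator {0<..<1} s"
        using r by (auto simp: indicator_def intro!: mult_right_mono epowr_mono mult_left_mono)
    qed
    also have "\<dots> = ennreal \<beta> * (\<integral>\<^sup>+ t\<in>{0<..<1}. ?w t * epowr (\<Psi> t) r \<partial>lborel)"
      unfolding \<tau>_def using \<beta>0 by (intro nn_integral_interp_subst) auto
    also have "\<dots> \<le> ennreal \<beta> * (\<integral>\<^sup>+ t. ennreal (2 powr r) * (ennreal ((1 + p) powr r) * (?w t * epowr (head_norm M p f t) r * indicator {0<..<1} t)
        + ennreal ((1 - ln t) powr (r * (\<theta> * \<beta> - \<beta>) - 1) / t) * epowr (A t) r * indicator {0<..<1} t) \<partial>lborel)"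
    proof (intro mult_left_mono nn_integral_mono)
      fix t :: real
      show "?w t * epowr (\<Psi> t) r * indicator {0<..<1} t
        \<le> ennreal (2 powr r) * (ennreal ((1 + p) powr r) * (?w t * epowr (head_norm M p f t) r * indicator {0<..<1} t)
        + ennreal ((1 - ln t) powr (r * (\<theta> * \<beta> - \<beta>) - 1) / t) * epowr (A t) r * indicator {0<..<1} t)"
      proof (cases "t \<in> {0<..<1}")
        case True
        then have t: "0 < t" "t < 1" by auto
        have "epowr (\<Psi> t) r \<le> ennreal (2 powr r) * (ennreal ((1 + p) powr r) * epowr (head_norm M p f t) r
            + ennreal (((1 - ln t) powr (- \<beta>)) powr r) * epowr (A t) r)"
          unfolding \<Psi>_def using r p
          by (intro order_trans[OF epowr_add_le]) (auto simp: epowr_mult epowr_ennreal simp del: ennreal_plus)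
        then have "?w t * epowr (\<Psi> t) r \<le> ?w t * (ennreal (2 powr r) * (ennreal ((1 + p) powr r) * epowr (head_norm M p f t) r
            + ennreal (((1 - ln t) powr (- \<beta>)) powr r) * epowr (A t) r))"
          by (rule mult_left_mono) simp
        also have "\<dots> = ennreal (2 powr r) * (ennreal ((1 + p) powr r) * (?w t * epowr (head_norm M p f t) r)
            + (?w t * ennreal (((1 - ln t) powr (- \<beta>)) powr r)) * epowr (A t) r)"
          by (simp add: distrib_left ac_simps)
        also have "?w t * ennreal (((1 - ln t) powr (- \<beta>)) powr r) = ennreal ((1 - ln t) powr (r * (\<theta> * \<beta> - \<beta>) - 1) / t)"
        proof -
          have "(1 - ln t) powr (r * (\<theta> * \<beta>) - 1) * ((1 - ln t) powr (- \<beta>)) powr r = (1 - ln t) powr (r * (\<theta> * \<beta> - \<beta>) - 1)"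
            by (simp add: powr_powr powr_add[symmetric] algebra_simps)
          then show ?thesis using t by (simp flip: ennreal_mult)
        qed
        finally show ?thesis using True by simp
      qed simp
    qed simp
    also have "\<dots> = ennreal \<beta> * (ennreal (2 powr r) * (ennreal ((1 + p) powr r) * J f
        + (\<integral>\<^sup>+ t\<in>{0<..<1}. ennreal ((1 - ln t) powr (r * (\<theta> * \<beta> - \<beta>) - 1) / t) * epowr (A t) r \<partial>lborel)))"
    proof -
      have "(\<integral>\<^sup>+ t. a * (b * U t + V t) \<partial>lborel) = a * (b * (\<integral>\<^sup>+ t. U t \<partial>lborel) + (\<integral>\<^sup>+ t. V t \<partial>lborel))"
        if [measurable]: "U \<in> borel_measurable borel" "V \<in> borel_measurable borel"
        for a b :: ennreal and U V :: "real \<Rightarrow> ennreal"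
        by (simp add: nn_integral_cmult nn_integral_add)
      then show ?thesis unfolding J_def by (intro arg_cong[where f="(*) (ennreal \<beta>)"]) measurable
    qed
    also have "\<dots> \<le> ennreal \<beta> * (ennreal (2 powr r) * (ennreal ((1 + p) powr r) * J f
        + ennreal ((\<beta> - \<theta> * \<beta>) powr (- r)) * J f))"
      unfolding A_def J_def using \<theta> \<beta>0 r
      by (intro mult_left_mono add_left_mono hardy_log_powr) auto
    also have "\<dots> = ennreal D * J f"
    proof -
      have "ennreal D = ennreal \<beta> * (ennreal (2 powr r) * (ennreal ((1 + p) powr r) + ennreal ((\<beta> - \<theta> * \<beta>) powr (- r))))"
        using \<beta>0 unfolding D_def mult.assoc by (subst ennreal_mult, simp, simp, subst ennreal_mult) auto
      then show ?thesis by (simp add: distrib_right mult.assoc)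
    qed
    finally show ?thesis .
  qed
  have I: "I f = epowr (L f) (1 / r)" for f
    unfolding I_def interp_norm_def L_def K_def ..
  have G: "G f = epowr (J f) (1 / r)" for f
    unfolding G_def J_def ..
  show thesis
  proof (rule that)
    show "0 < (c powr r / \<beta>) powr (1 / r)" "0 < D powr (1 / r)" using c \<beta>0 D by auto
  qed (use low up c \<beta>0 D r in \<open>auto simp: I G intro!: epowr_root_le\<close>)
qed

theorem theorem1p7:
  fixes \<Omega> :: "(real ^ 'n) set" and n :: nat and p \<theta> r :: real and w1 :: "real \<Rightarrow> real"
  assumes "n = CARD('n)" and "n \<ge> 2" and "p = real n / (real n - 1)"
    and "open \<Omega>" and "bounded \<Omega>" and "emeasure lebesgue \<Omega> = 1"
    and "0 < \<theta>" and "\<theta> < 1" and "1 \<le> r"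
    and "\<And>t. 0 < t \<Longrightarrow> t < 1 \<Longrightarrow> w1 t = t powr (-1) * (1 - ln t) powr (r * \<theta> / real n - 1)"
  defines "M \<equiv> lebesgue_on \<Omega>"
  shows "interp_space M (Lp_norm M p) (small_Lp_norm M p) \<theta> r
           = fun_space M (GGamma_norm M p r w1 (\<lambda>_. 1))
       \<and> equivalent_on (fun_space M (GGamma_norm M p r w1 (\<lambda>_. 1)))
           (interp_norm M (Lp_norm M p) (small_Lp_norm M p) \<theta> r)
           (GGamma_norm M p r w1 (\<lambda>_. 1))"
proof -
  have M: "emeasure M (space M) = 1"
    using assms(4,6) by (simp add: M_def space_restrict_space emeasure_restrict_space)
  define \<beta> where "\<beta> = 1 - 1 / p"
  have p: "1 < p" using \<open>n \<ge> 2\<close> by (simp add: \<open>p = _\<close> field_simps)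
  \<comment> \<open>The conjugate exponent turns the weight of the general theorem into the given \<open>w1\<close>.\<close>
  have \<beta>n: "\<beta> = 1 / real n" using \<open>n \<ge> 2\<close> by (simp add: \<beta>_def \<open>p = _\<close> field_simps)
  let ?I = "interp_norm M (Lp_norm M p) (small_Lp_norm M p) \<theta> r"
  let ?G = "GGamma_norm M p r w1 (\<lambda>_. 1)"
  have G: "?G f = epowr (\<integral>\<^sup>+ t\<in>{0<..<1}. ennreal ((1 - ln t) powr (r * (\<theta> * \<beta>) - 1) / t)
                * epowr (head_norm M p f t) r \<partial>lborel) (1 / r)" for f
  proof (rule GGamma_norm_eq_head_norm)
    fix t :: real assume "0 < t" "t < 1"
    then show "w1 t = (1 - ln t) powr (r * (\<theta> * \<beta>) - 1) / t"
      by (simp add: assms(10) \<beta>n powr_minus_divide)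
  qed
  obtain C D where C: "0 < C" "0 < D"
    and low: "\<And>f. f \<in> borel_measurable M \<Longrightarrow> ?G f \<le> ennreal C * ?I f"
    and up: "\<And>f. f \<in> borel_measurable M \<Longrightarrow> ?I f \<le> ennreal D * ?G f"
    using interp_norm_equivalent[OF M p \<beta>_def assms(8,9)] unfolding G[symmetric] by metis
  \<comment> \<open>Without a decomposition the K-functional is an infimum over the empty set, hence infinite.\<close>
  have dec: "decompositions M (Lp_norm M p) (small_Lp_norm M p) f \<noteq> {}" if "?I f < top" for f
  proof
    assume empty: "decompositions M (Lp_norm M p) (small_Lp_norm M p) f = {}"
    have "(\<integral>\<^sup>+ t\<in>{0<..<1}. epowr (ennreal (t powr (- \<theta>)) * K_functional M (Lp_norm M p) (small_Lp_norm M p) f t) r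
        * ennreal (1 / t) \<partial>lborel) = (\<integral>\<^sup>+ t. top * indicator {0<..<1::real} t \<partial>lborel)"
      by (intro nn_integral_cong) (auto simp: K_functional_def empty indicator_def ennreal_mult_top ennreal_top_mult)
    also have "\<dots> = top" by (subst nn_integral_cmult_indicator) (auto simp: ennreal_top_mult)
    finally show False using that by (simp add: interp_norm_def)
  qed
  have "?I f < top \<longleftrightarrow> ?G f < top" if "f \<in> borel_measurable M" for f
    using low[OF that] up[OF that] by (auto elim!: le_less_trans simp: ennreal_mult_less_top)
  then have "interp_space M (Lp_norm M p) (small_Lp_norm M p) \<theta> r = fun_space M ?G"
    using dec by (auto simp: interp_space_def fun_space_def)
  moreover have "equivalent_on (fun_space M ?G) ?I ?G"
    unfolding equivalent_on_def
  proof (intro exI conjI ballI)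
    show "0 < 1 / D" "0 < C" using C by auto
    fix f assume "f \<in> fun_space M ?G"
    then have f: "f \<in> borel_measurable M" by (simp add: fun_space_def)
    show "?G f \<le> ennreal C * ?I f" by (rule low[OF f])
    have "ennreal (1 / D) * ?I f \<le> ennreal (1 / D) * (ennreal D * ?G f)"
      by (intro mult_left_mono up f) simp
    then show "ennreal (1 / D) * ?I f \<le> ?G f"
      using C by (simp add: mult.assoc[symmetric] flip: ennreal_mult)
  qed
  ultimately show ?thesis by blast
qed

end
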